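(* Let $M$ be a lattice and let $P \subseteq M_{\mathbb{R}}$ be an $n$-dimensional lattice polytope whose $h^*$-polynomial has degree $d$ and linear coefficient $h^*_1$. If $$n \geq h^*_1 (2d+1) + 4d - 1,$$ then $P$ is a lattice pyramid over an $(n-1)$-dimensional lattice polytope.
   Context: A lattice $M$ is a free abelian group of finite rank, and $M_{\mathbb{R}} = M \otimes_{\mathbb{Z}} \mathbb{R}$. A lattice polytope $P \subseteq M_{\mathbb{R}}$ is a polytope all of whose vertices lie in $M$. All lattice notions for $P$ are taken with respect to the affine lattice $\operatorname{aff}(P) \cap M$. For an $n$-dimensional lattice polytope $P$ one has $$\sum_{k \geq 0} |kP \cap M|\, t^k = \frac{h^*_0 + h^*_1 t + \cdots + h^*_n t^n}{(1-t)^{n+1}}$$ with non-negative integers $h^*_i$ (for $k=0$ the number of lattice points is $1$). The numerator is the $h^*$-polynomial of $P$; its degree is the maximal $i$ with $h^*_i \neq 0$. One has $h^*_1 = |P \cap M| - n - 1$ (for $n=0$ put $h^*_1 = 0$). Two lattice polytopes $P \subseteq M_{\mathbb{R}}$ and $P' \subseteq M'_{\mathbb{R}}$ are isomorphic if there is an affine lattice isomorphism $\operatorname{aff}(P)\cap M \cong \operatorname{aff}(P')\cap M'$ mapping the vertices of $P$ onto the vertices of $P'$. For a lattice polytope $B \subseteq \mathbb{R}^k$ with respect to $\mathbb{Z}^k$, the ($1$-fold) standard pyramid over $B$ is $\operatorname{conv}(\{0\} \cup (B \times \{1\})) \subseteq \mathbb{R}^{k+1}$, a lattice polytope with respect to $\mathbb{Z}^{k+1}$;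 the $l$-fold standard pyramid is obtained by iterating this $l$ times, and the $0$-fold standard pyramid over $B$ is $B$ itself. For lattice polytopes $Q \subseteq P$, we say that $P$ is a lattice pyramid over $Q$ if $P$ is isomorphic to the $(\dim(P)-\dim(Q))$-fold standard pyramid over some lattice polytope $B$ by an isomorphism mapping $Q$ onto the copy of $B$ in this standard pyramid. Convention: the empty set counts as a lattice polytope of dimension $-1$, and a single lattice point is a lattice pyramid over it. *)

theory Defs
  imports
    "HOL-Analysis.Analysis"
    "HOL-Analysis.Finite_Function_Topology"
    "HOL-Computational_Algebra.Polynomial_FPS"
begin

text \<open>
  A free abelian group of finite rank, realised as the integer span of a finite
  set that is linearly independent over the reals, so that \<open>span M\<close> is
  \<open>M \<otimes> \<real>\<close>. The rank may be smaller than the dimension of the ambient space;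
  in particular \<open>M = {0}\<close> is a lattice.
\<close>
definition is_lattice :: "'a::real_vector set \<Rightarrow> bool" where
  "is_lattice M \<longleftrightarrow>
     (\<exists>B. finite B \<and> independent B \<and>
          M = {\<Sum>b\<in>B. of_int (c b) *\<^sub>R b | c :: 'a \<Rightarrow> int. True})"

definition vertices :: "'a::real_vector set \<Rightarrow> 'a set" where
  "vertices P = {v. v extreme_point_of P}"

text \<open>The empty set is a lattice polytope, of dimension \<open>aff_dim {} = -1\<close>.\<close>
definition lattice_polytope :: "'a::real_vector set \<Rightarrow> 'a set \<Rightarrow> bool" where
  "lattice_polytope M P \<longleftrightarrow> polytope P \<and> vertices P \<subseteq> M"

text \<open>
  For \<open>P\<close> a lattice polytope, \<open>kP \<inter> M\<close> has the same cardinality as the set of lattice points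
  counted with respect to the affine lattice \<open>affine hull P \<inter> M\<close> (take a lattice point of
  \<open>P\<close> as the origin).
\<close>
definition ehrhart :: "'a::real_vector set \<Rightarrow> 'a set \<Rightarrow> nat \<Rightarrow> nat" where
  "ehrhart M P k = (if k = 0 then 1 else card ((\<lambda>x. real k *\<^sub>R x) ` P \<inter> M))"

definition h_star :: "'a::euclidean_space set \<Rightarrow> 'a set \<Rightarrow> int poly" where
  "h_star M P =
     (THE h. fps_of_poly h =
        Abs_fps (\<lambda>k. int (ehrhart M P k)) * (1 - fps_X) ^ nat (aff_dim P + 1))"

text \<open>
  A map between abelian torsors is affine iff it preserves \<open>x + y - z\<close>. Only the
  values of \<open>\<phi>\<close> on \<open>affine hull P \<inter> M\<close> matter.
\<close>
definition polytope_iso ::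
  "'a::real_vector set \<Rightarrow> 'a set \<Rightarrow> 'b::real_vector set \<Rightarrow> 'b set \<Rightarrow> ('a \<Rightarrow> 'b) \<Rightarrow> bool" where
  "polytope_iso M P M' P' \<phi> \<longleftrightarrow>
     bij_betw \<phi> (affine hull P \<inter> M) (affine hull P' \<inter> M') \<and>
     (\<forall>x\<in>affine hull P \<inter> M. \<forall>y\<in>affine hull P \<inter> M. \<forall>z\<in>affine hull P \<inter> M.
        \<phi> (x + y - z) = \<phi> x + \<phi> y - \<phi> z) \<and>
     \<phi> ` vertices P = vertices P'"

text \<open>
  All the spaces \<open>\<real>\<^sup>k\<close> live inside the finitely supported real sequences: \<open>\<real>\<^sup>k\<close> consists of the
  sequences supported on \<open>{..<k}\<close>, and \<open>(x, 1) \<in> \<real>\<^sup>k \<times> {1}\<close> is \<open>x + Poly_Mapping.single k 1\<close>.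
\<close>
definition int_lattice :: "nat \<Rightarrow> (nat \<Rightarrow>\<^sub>0 real) set" where
  "int_lattice k =
     {x. Poly_Mapping.keys x \<subseteq> {..<k} \<and> (\<forall>i. Poly_Mapping.lookup x i \<in> \<int>)}"

definition lift_one :: "nat \<Rightarrow> (nat \<Rightarrow>\<^sub>0 real) \<Rightarrow> (nat \<Rightarrow>\<^sub>0 real)" where
  "lift_one k x = x + Poly_Mapping.single k 1"

text \<open>
  \<open>std_pyramid l k B\<close> is the \<open>l\<close>-fold standard pyramid over \<open>B \<subseteq> \<real>\<^sup>k\<close>, a subset of \<open>\<real>\<^bsup>k+l\<^esup>\<close>,
  and \<open>std_base l k B\<close> is the copy of \<open>B\<close> in it.
\<close>
primrec std_pyramid :: "nat \<Rightarrow> nat \<Rightarrow> (nat \<Rightarrow>\<^sub>0 real) set \<Rightarrow> (nat \<Rightarrow>\<^sub>0 real) set" where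
  "std_pyramid 0 k B = B"
| "std_pyramid (Suc l) k B = convex hull ({0} \<union> lift_one (k + l) ` std_pyramid l k B)"

primrec std_base :: "nat \<Rightarrow> nat \<Rightarrow> (nat \<Rightarrow>\<^sub>0 real) set \<Rightarrow> (nat \<Rightarrow>\<^sub>0 real) set" where
  "std_base 0 k B = B"
| "std_base (Suc l) k B = lift_one (k + l) ` std_base l k B"

text \<open>
  Since \<open>\<phi>\<close> is defined on lattice points, that it maps the lattice polytope \<open>Q\<close> onto the copy
  of \<open>B\<close> is expressed through the vertices, as in \<open>polytope_iso\<close>. The polytope \<open>B\<close> may be
  empty; this makes a single lattice point a lattice pyramid over the empty set.
\<close>
definition lattice_pyramid_over :: "'a::euclidean_space set \<Rightarrow> 'a set \<Rightarrow> 'a set \<Rightarrow> bool" where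
  "lattice_pyramid_over M P Q \<longleftrightarrow>
     lattice_polytope M P \<and> lattice_polytope M Q \<and> Q \<subseteq> P \<and>
     (\<exists>k B \<phi>. let l = nat (aff_dim P - aff_dim Q) in
        lattice_polytope (int_lattice k) B \<and>
        polytope_iso M P (int_lattice (k + l)) (std_pyramid l k B) \<phi> \<and>
        \<phi> ` vertices Q = vertices (std_base l k B))"

end

(*
  Homogenize: let W be the lattice points of P placed at height 1, N = n + 1 the dimension of
  their span, and L the lattice M x Z.

  A half-open decomposition of a regular triangulation shows that the h*-polynomial exists and
  that a lattice point of height k in the interior of the cone over W forces d >= N - k.

  Fix a basis sigma of span W inside W. The bound gives two facts.
  - A lattice point of the half-open parallelepiped of sigma has at most 2d non-zero coordinates,
    since it and its reflection both become interior after adding generators. As these points form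
    a group, averaging shows that fewer than 4d elements of sigma occur in them (none if d = 0).
  - Each w in W outside sigma depends on at most 2d + 1 elements of sigma, because each side of the
    affine dependence has at most d + 1 elements.
  As h*_1 = |W| - N, the hypothesis leaves some v in sigma untouched. Then the v-coordinate
  vanishes on W - {v} and is integral on the lattice, which makes v the apex of a lattice pyramid.
*)
theory Submission
  imports Defs
begin

section \<open>Regular triangulations of a cone\<close>

text \<open>The decomposition is used for its signs. Every coefficient of the numerator is a sum of
  cardinalities, so nothing cancels, and a single box point of height m forces degree at least m.
  Hence the degree bound needs only one reflected point, not the full reciprocity law.

  The triangulation is found by linear programming instead of polyhedral geometry. A generic cost on
  the generators singles out the dual feasible bases; minimality of cost gives covering, and
  comparing the costs of two bases gives disjointness. Points on walls are assigned by pushing them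
  slightly along a generic interior direction q, or along -q for a point that is about to be
  reflected.

  Constants: with N = n + 1 the hypothesis reads N >= h*_1 (2d + 1) + 4d, while at most (4d - 1) +
  h*_1 (2d + 1) elements of sigma are touched. The case d = 0 stands apart: there h*_1 = 0, nothing
  is touched, and N > 0 provides the apex.\<close>

lemma exists_positive_generic_weight:
  fixes A :: "('b \<Rightarrow> real) set"
  assumes "finite W" "finite A" "\<And>a. a \<in> A \<Longrightarrow> \<exists>w\<in>W. a w \<noteq> 0"
  obtains \<omega> :: "'b \<Rightarrow> real"
  where "\<And>w. \<omega> w > 0" "\<And>a. a \<in> A \<Longrightarrow> (\<Sum>w\<in>W. a w * \<omega> w) \<noteq> 0"
proof -
  obtain e :: "'b \<Rightarrow> nat" where e: "inj_on e W"
    using assms(1) finite_imp_inj_to_nat_seg by blast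
  \<comment> \<open>Weights \<open>t ^ e w\<close> with distinct exponents turn each condition into
    a non-zero polynomial in \<open>t\<close>, so all but finitely many positive \<open>t\<close>
    will do.\<close>
  define p where "p a = (\<Sum>w\<in>W. monom (a w) (e w))" for a :: "'b \<Rightarrow> real"
  have p0: "p a \<noteq> 0" if "a \<in> A" for a
  proof -
    obtain w where w: "w \<in> W" "a w \<noteq> 0" using assms(3) \<open>a \<in> A\<close> by blast
    have "coeff (p a) (e w) = (\<Sum>v\<in>W. if v = w then a v else 0)"
      unfolding p_def coeff_sum coeff_monom
      by (rule sum.cong) (use e w in \<open>auto dest: inj_onD\<close>)
    also have "\<dots> = a w" using w assms(1) by simp
    finally show ?thesis using w by auto
  qed
  have "finite (\<Union>a\<in>A. {x. poly (p a) x = 0})"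
    using assms(2) p0 by (auto simp: poly_roots_finite)
  then have "\<exists>t. t \<in> {0<..} - (\<Union>a\<in>A. {x. poly (p a) x = 0})"
    using infinite_Ioi[of "0::real"] by (metis Diff_infinite_finite all_not_in_conv finite.emptyI)
  then obtain t where t: "t > 0" "\<And>a. a \<in> A \<Longrightarrow> poly (p a) t \<noteq> 0" by auto
  show ?thesis
  proof (rule that[of "\<lambda>w. t ^ e w"])
    show "(\<Sum>w\<in>W. a w * t ^ e w) \<noteq> 0" if "a \<in> A" for a
      using t(2)[OF that] by (simp add: p_def poly_sum poly_monom)
  qed (use t in auto)
qed

text \<open>Positivity of \<open>a + \<epsilon> * b\<close> for an infinitesimal positive
  \<epsilon>.\<close>

definition sign_pos :: "real \<Rightarrow> real \<Rightarrow> bool"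
  where "sign_pos a b \<longleftrightarrow> a > 0 \<or> (a = 0 \<and> b > 0)"

lemma eventually_sign_pos:
  assumes "b \<noteq> 0"
  shows "\<forall>\<^sub>F \<epsilon> in at_right 0. a + \<epsilon> * b \<noteq> 0 \<and> (a + \<epsilon> * b > 0 \<longleftrightarrow> sign_pos a b)"
proof (cases "a = 0")
  case True
  then show ?thesis using assms
    by (auto simp: sign_pos_def zero_less_mult_iff intro!: eventually_at_rightI[of 0 1])
next
  case False
  have "a + \<epsilon> * b \<noteq> 0 \<and> (a + \<epsilon> * b > 0 \<longleftrightarrow> sign_pos a b)" if "\<epsilon> \<in> {0<..<\<bar>a\<bar> / \<bar>b\<bar>}" for \<epsilon>
  proof -
    have "\<bar>\<epsilon> * b\<bar> < \<bar>a\<bar>" using that assms by (simp add: abs_mult field_simps)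
    then show ?thesis using False unfolding sign_pos_def by linarith
  qed
  then show ?thesis using False assms by (intro eventually_at_rightI[of 0 "\<bar>a\<bar> / \<bar>b\<bar>"]) auto
qed

text \<open>The common height 1 makes heights on the cone non-negative and makes the coordinates of
  a generator in any basis sum to 1.\<close>

locale graded_generators =
  fixes W :: "'b::real_vector set" and ht :: "'b \<Rightarrow> real"
  assumes finite_W: "finite W" and linear_ht: "linear ht" and ht_W: "w \<in> W \<Longrightarrow> ht w = 1"
begin

definition Bases :: "'b set set"
  where "Bases = {\<sigma>. \<sigma> \<subseteq> W \<and> independent \<sigma> \<and> W \<subseteq> span \<sigma>}"

definition Cone :: "'b set"
  where "Cone = {\<Sum>w\<in>W. \<mu> w *\<^sub>R w | \<mu>. \<forall>w\<in>W. \<mu> w \<ge> 0}"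

lemma finite_Bases: "finite Bases"
  by (rule finite_subset[of _ "Pow W"]) (auto simp: Bases_def finite_W)

lemma Bases_subset: "\<sigma> \<in> Bases \<Longrightarrow> \<sigma> \<subseteq> W"
  and Bases_independent: "\<sigma> \<in> Bases \<Longrightarrow> independent \<sigma>"
  and finite_basis: "\<sigma> \<in> Bases \<Longrightarrow> finite \<sigma>"
  by (auto simp: Bases_def intro: finite_subset[OF _ finite_W])

lemma span_basis: "\<sigma> \<in> Bases \<Longrightarrow> span \<sigma> = span W"
  unfolding Bases_def using span_mono[of \<sigma> W] span_minimal[of W "span \<sigma>"] by auto

lemma card_basis: "\<sigma> \<in> Bases \<Longrightarrow> card \<sigma> = dim W"
  by (simp add: Bases_def basis_card_eq_dim)

lemma extend_to_basis:
  assumes "S \<subseteq> W" "independent S"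
  obtains \<sigma> where "\<sigma> \<in> Bases" "S \<subseteq> \<sigma>"
proof -
  obtain \<sigma> where "S \<subseteq> \<sigma>" "\<sigma> \<subseteq> W" "independent \<sigma>" "W \<subseteq> span \<sigma>"
    by (rule maximal_independent_subset_extend[OF assms])
  then show ?thesis using that[of \<sigma>] by (simp add: Bases_def)
qed

section \<open>Coordinates with respect to a basis of generators, and the cone\<close>

lemma sum_rep: "\<sigma> \<in> Bases \<Longrightarrow> y \<in> span W \<Longrightarrow> (\<Sum>i\<in>\<sigma>. representation \<sigma> y i *\<^sub>R i) = y"
  by (simp add: Bases_independent finite_basis real_vector.sum_representation_eq span_basis)

lemma rep_add: "\<sigma> \<in> Bases \<Longrightarrow> x \<in> span W \<Longrightarrow> y \<in> span W \<Longrightarrow>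
    representation \<sigma> (x + y) i = representation \<sigma> x i + representation \<sigma> y i"
  by (simp add: Bases_independent real_vector.representation_add span_basis)

lemma rep_diff: "\<sigma> \<in> Bases \<Longrightarrow> x \<in> span W \<Longrightarrow> y \<in> span W \<Longrightarrow>
    representation \<sigma> (x - y) i = representation \<sigma> x i - representation \<sigma> y i"
  by (simp add: Bases_independent real_vector.representation_diff span_basis)

lemma rep_scale: "\<sigma> \<in> Bases \<Longrightarrow> y \<in> span W \<Longrightarrow>
    representation \<sigma> (c *\<^sub>R y) i = c * representation \<sigma> y i"
  by (simp add: Bases_independent real_vector.representation_scale span_basis)

lemma rep_basis: "\<sigma> \<in> Bases \<Longrightarrow> j \<in> \<sigma> \<Longrightarrow> representation \<sigma> j i = (if i = j then 1 else 0)"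
  by (simp add: Bases_independent real_vector.representation_basis)

lemma rep_lincomb:
  assumes "\<sigma> \<in> Bases" "A \<subseteq> span W"
  shows "representation \<sigma> (\<Sum>w\<in>A. c w *\<^sub>R w) i = (\<Sum>w\<in>A. c w * representation \<sigma> w i)"
proof -
  have "representation \<sigma> (\<Sum>w\<in>A. c w *\<^sub>R w) = (\<lambda>i. \<Sum>w\<in>A. representation \<sigma> (c w *\<^sub>R w) i)"
    using assms by (intro real_vector.representation_sum)
      (auto simp: Bases_independent span_basis intro: span_scale)
  moreover have "(\<Sum>w\<in>A. representation \<sigma> (c w *\<^sub>R w) i) = (\<Sum>w\<in>A. c w * representation \<sigma> w i)"
    using assms by (intro sum.cong) (auto simp: rep_scale)
  ultimately show ?thesis by simp
qed

lemma rep_basis_lincomb: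
  assumes "\<sigma> \<in> Bases" "i \<in> \<sigma>"
  shows "representation \<sigma> (\<Sum>j\<in>\<sigma>. c j *\<^sub>R j) i = c i"
proof -
  have "\<sigma> \<subseteq> span W" using Bases_subset[OF assms(1)] span_superset by blast
  then have "representation \<sigma> (\<Sum>j\<in>\<sigma>. c j *\<^sub>R j) i = (\<Sum>j\<in>\<sigma>. c j * representation \<sigma> j i)"
    by (rule rep_lincomb[OF assms(1)])
  also have "\<dots> = (\<Sum>j\<in>\<sigma>. if i = j then c j else 0)"
    by (rule sum.cong) (auto simp: rep_basis assms)
  finally show ?thesis using assms by (simp add: finite_basis)
qed

lemma lincomb_in_span: "A \<subseteq> W \<Longrightarrow> (\<Sum>w\<in>A. c w *\<^sub>R w) \<in> span W"
  by (intro span_sum span_scale) (auto intro: span_base)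

lemma ht_lincomb: "A \<subseteq> W \<Longrightarrow> ht (\<Sum>w\<in>A. c w *\<^sub>R w) = (\<Sum>w\<in>A. c w)"
  by (simp add: linear_sum[OF linear_ht] linear_scale[OF linear_ht] ht_W subset_iff)

lemma ht_rep:
  assumes "\<sigma> \<in> Bases" "y \<in> span W"
  shows "ht y = (\<Sum>i\<in>\<sigma>. representation \<sigma> y i)"
  using ht_lincomb[OF Bases_subset[OF assms(1)], of "representation \<sigma> y"] sum_rep[OF assms] by simp

lemma lincomb_subset:
  assumes "A \<subseteq> W"
  shows "(\<Sum>w\<in>W. (if w \<in> A then c w else 0) *\<^sub>R w) = (\<Sum>w\<in>A. c w *\<^sub>R w)"
proof -
  have "(\<Sum>w\<in>W. (if w \<in> A then c w else 0) *\<^sub>R w) = (\<Sum>w\<in>W. if w \<in> A then c w *\<^sub>R w else 0)"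
    by (rule sum.cong) auto
  then show ?thesis using assms finite_W
    by (simp add: sum.inter_restrict[symmetric] Int_absorb1)
qed

lemma ConeI: "A \<subseteq> W \<Longrightarrow> (\<And>w. w \<in> A \<Longrightarrow> c w \<ge> 0) \<Longrightarrow> (\<Sum>w\<in>A. c w *\<^sub>R w) \<in> Cone"
  unfolding Cone_def
  using lincomb_subset[of A c] by (auto intro!: exI[of _ "\<lambda>w. if w \<in> A then c w else 0"])

lemma Cone_subset_span: "Cone \<subseteq> span W"
  by (auto simp: Cone_def lincomb_in_span)

lemma Cone_add: "x \<in> Cone \<Longrightarrow> y \<in> Cone \<Longrightarrow> x + y \<in> Cone"
  unfolding Cone_def
proof safe
  fix \<mu> \<nu> :: "'b \<Rightarrow> real" assume "\<forall>w\<in>W. 0 \<le> \<mu> w" "\<forall>w\<in>W. 0 \<le> \<nu> w"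
  then show "\<exists>\<mu>'. (\<Sum>w\<in>W. \<mu> w *\<^sub>R w) + (\<Sum>w\<in>W. \<nu> w *\<^sub>R w) = (\<Sum>w\<in>W. \<mu>' w *\<^sub>R w) \<and> (\<forall>w\<in>W. 0 \<le> \<mu>' w)"
    by (intro exI[of _ "\<lambda>w. \<mu> w + \<nu> w"]) (auto simp: scaleR_left_distrib sum.distrib)
qed

lemma Cone_scale: "x \<in> Cone \<Longrightarrow> c \<ge> 0 \<Longrightarrow> c *\<^sub>R x \<in> Cone"
  unfolding Cone_def
proof safe
  fix \<mu> :: "'b \<Rightarrow> real" assume "\<forall>w\<in>W. 0 \<le> \<mu> w" "c \<ge> 0"
  then show "\<exists>\<mu>'. c *\<^sub>R (\<Sum>w\<in>W. \<mu> w *\<^sub>R w) = (\<Sum>w\<in>W. \<mu>' w *\<^sub>R w) \<and> (\<forall>w\<in>W. 0 \<le> \<mu>' w)"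
    by (intro exI[of _ "\<lambda>w. c * \<mu> w"]) (auto simp: scaleR_sum_right)
qed

lemma Cone_if_rep_nonneg:
  assumes "\<sigma> \<in> Bases" "y \<in> span W" "\<And>i. i \<in> \<sigma> \<Longrightarrow> representation \<sigma> y i \<ge> 0"
  shows "y \<in> Cone"
  using ConeI[OF Bases_subset[OF assms(1)], of "representation \<sigma> y"] sum_rep[OF assms(1,2)] assms(3)
  by simp

lemma ht_Cone_nonneg: "y \<in> Cone \<Longrightarrow> ht y \<ge> 0"
  by (auto simp: Cone_def ht_lincomb intro!: sum_nonneg)

text \<open>Conic Caratheodory: a representation of minimal support is supported on an independent set.\<close>

lemma Cone_in_simplicial_cone:
  assumes "y \<in> Cone"
  obtains \<sigma> where "\<sigma> \<in> Bases" "\<And>i. i \<in> \<sigma> \<Longrightarrow> representation \<sigma> y i \<ge> 0"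
proof -
  define ok where "ok S \<longleftrightarrow> S \<subseteq> W \<and> (\<exists>\<mu>. (\<forall>w\<in>S. \<mu> w > 0) \<and> y = (\<Sum>w\<in>S. \<mu> w *\<^sub>R w))" for S
  obtain \<mu>0 where \<mu>0: "\<forall>w\<in>W. \<mu>0 w \<ge> 0" "y = (\<Sum>w\<in>W. \<mu>0 w *\<^sub>R w)"
    using assms unfolding Cone_def by blast
  have "ok {w\<in>W. \<mu>0 w \<noteq> 0}"
    unfolding ok_def
  proof (intro conjI exI[of _ \<mu>0] ballI)
    show "y = (\<Sum>w\<in>{w\<in>W. \<mu>0 w \<noteq> 0}. \<mu>0 w *\<^sub>R w)"
      unfolding \<mu>0(2) by (rule sum.mono_neutral_right) (auto simp: finite_W)
  qed (use \<mu>0(1) in force)+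
  then obtain S where S: "ok S" and min: "\<And>S'. ok S' \<Longrightarrow> card S \<le> card S'"
    using ex_has_least_nat[of ok _ card] by blast
  obtain \<mu> where SW: "S \<subseteq> W" and \<mu>: "\<And>w. w \<in> S \<Longrightarrow> \<mu> w > 0" "y = (\<Sum>w\<in>S. \<mu> w *\<^sub>R w)"
    using S unfolding ok_def by blast
  have finS: "finite S" using SW finite_W finite_subset by blast
  have "independent S"
  proof
    assume "dependent S"
    then obtain u where u: "(\<Sum>v\<in>S. u v *\<^sub>R v) = 0" "\<exists>v\<in>S. u v \<noteq> 0"
      using dependent_finite[OF finS] by blast
    obtain v0 where v0: "v0 \<in> S" "u v0 \<noteq> 0" using u(2) by blast
    \<comment> \<open>The sign makes the coefficient at \<open>v0\<close> positive, so that
      \<open>R\<close> below is non-empty.\<close>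
    define a where "a v = u v * sgn (u v0)" for v
    have a0: "(\<Sum>v\<in>S. a v *\<^sub>R v) = 0"
    proof -
      have "(\<Sum>v\<in>S. a v *\<^sub>R v) = sgn (u v0) *\<^sub>R (\<Sum>v\<in>S. u v *\<^sub>R v)"
        by (simp add: a_def scaleR_sum_right mult.commute)
      then show ?thesis using u(1) by simp
    qed
    have av0: "a v0 > 0" using v0 by (simp add: a_def sgn_if)
    define R where "R = {v\<in>S. a v > 0}"
    \<comment> \<open>The largest multiple of the dependence that can be subtracted with all
      coefficients staying non-negative; the one at \<open>j\<close> then vanishes.\<close>
    define \<theta> where "\<theta> = Min ((\<lambda>v. \<mu> v / a v) ` R)"
    have R: "finite R" "R \<noteq> {}" using finS av0 v0 unfolding R_def by auto
    obtain j where j: "j \<in> R" "\<theta> = \<mu> j / a j"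
      using Min_in[of "(\<lambda>v. \<mu> v / a v) ` R"] R unfolding \<theta>_def
      by (metis (no_types, lifting) finite_imageI image_is_empty imageE)
    have \<theta>le: "\<theta> \<le> \<mu> v / a v" if "v \<in> R" for v
      using that R unfolding \<theta>_def by auto
    define \<nu> where "\<nu> v = \<mu> v - \<theta> * a v" for v
    have \<theta>0: "\<theta> > 0" using j \<mu>(1) by (auto simp: R_def)
    have \<nu>0: "\<nu> v \<ge> 0" if "v \<in> S" for v
    proof (cases "a v > 0")
      case True
      then show ?thesis using \<theta>le[of v] that by (simp add: R_def \<nu>_def field_simps)
    next
      case False
      then have "\<theta> * a v \<le> 0" using \<theta>0 by (simp add: mult_nonneg_nonpos)
      then show ?thesis using \<mu>(1)[OF that] by (simp add: \<nu>_def)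
    qed
    have \<nu>j: "\<nu> j = 0" using j by (auto simp: \<nu>_def R_def)
    have y\<nu>: "y = (\<Sum>v\<in>S. \<nu> v *\<^sub>R v)"
    proof -
      have "(\<Sum>v\<in>S. \<nu> v *\<^sub>R v) = (\<Sum>v\<in>S. \<mu> v *\<^sub>R v) - \<theta> *\<^sub>R (\<Sum>v\<in>S. a v *\<^sub>R v)"
        by (simp add: \<nu>_def scaleR_diff_left sum_subtractf scaleR_sum_right)
      then show ?thesis using a0 \<mu>(2) by simp
    qed
    have "ok {v\<in>S. \<nu> v \<noteq> 0}"
      unfolding ok_def
    proof (intro conjI exI[of _ \<nu>] ballI)
      show "y = (\<Sum>w\<in>{w\<in>S. \<nu> w \<noteq> 0}. \<nu> w *\<^sub>R w)"
        unfolding y\<nu> by (rule sum.mono_neutral_right) (auto simp: finS)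
    qed (use \<nu>0 SW in force)+
    then have "card S \<le> card {v\<in>S. \<nu> v \<noteq> 0}" by (rule min)
    moreover have "{v\<in>S. \<nu> v \<noteq> 0} \<subset> S" using j \<nu>j by (auto simp: R_def)
    ultimately show False using finS psubset_card_mono[of S] by (meson not_le)
  qed
  then obtain \<sigma> where \<sigma>: "\<sigma> \<in> Bases" "S \<subseteq> \<sigma>" using extend_to_basis SW by blast
  have "y = (\<Sum>w\<in>\<sigma>. (if w \<in> S then \<mu> w else 0) *\<^sub>R w)"
  proof -
    have "(\<Sum>w\<in>\<sigma>. (if w \<in> S then \<mu> w else 0) *\<^sub>R w) = (\<Sum>w\<in>S. (if w \<in> S then \<mu> w else 0) *\<^sub>R w)"
      by (rule sum.mono_neutral_right) (use \<sigma> finite_basis in auto)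
    then show ?thesis using \<mu>(2) by simp
  qed
  then have "representation \<sigma> y i = (if i \<in> S then \<mu> i else 0)" if "i \<in> \<sigma>" for i
    using rep_basis_lincomb[OF \<sigma>(1) that] by simp
  then show ?thesis using that[OF \<sigma>(1)] \<mu>(1) by (simp add: less_imp_le)
qed

section \<open>Linear programming over the bases\<close>

definition generic :: "'b \<Rightarrow> bool"
  where "generic y \<longleftrightarrow> y \<in> span W \<and> (\<forall>\<sigma>\<in>Bases. \<forall>i\<in>\<sigma>. representation \<sigma> y i \<noteq> 0)"

text \<open>The linear functional on \<open>span W\<close> that agrees with \<omega> on \<sigma>; in
  linear programming terms, the cost of writing \<open>y\<close> in the basis \<sigma>.\<close>

definition extend :: "('b \<Rightarrow> real) \<Rightarrow> 'b set \<Rightarrow> 'b \<Rightarrow> real"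
  where "extend \<omega> \<sigma> y = (\<Sum>i\<in>\<sigma>. representation \<sigma> y i * \<omega> i)"

text \<open>The maximal simplices of the regular triangulation induced by the heights \<open>\<omega>\<close>; in terms of
  linear programming, the dual feasible bases.\<close>
definition Tri :: "('b \<Rightarrow> real) \<Rightarrow> 'b set set"
  where "Tri \<omega> = {\<sigma>\<in>Bases. \<forall>w\<in>W - \<sigma>. extend \<omega> \<sigma> w < \<omega> w}"

text \<open>A tie is a linear equation in \<omega> whose coefficient at \<open>w\<close> is -1,
  because \<open>w\<close> lies outside \<sigma>. So every such equation is non-trivial, and a
  generic weight avoids them all.\<close>

lemma exists_generic_heights:
  obtains \<omega> where "\<And>\<sigma> w. \<sigma> \<in> Bases \<Longrightarrow> w \<in> W - \<sigma> \<Longrightarrow> extend \<omega> \<sigma> w \<noteq> \<omega> w"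
proof -
  define a :: "'b set \<times> 'b \<Rightarrow> 'b \<Rightarrow> real"
    where "a = (\<lambda>(\<sigma>, w) v. (if v \<in> \<sigma> then representation \<sigma> w v else 0) - (if v = w then 1 else 0))"
  define A where "A = a ` (SIGMA \<sigma>:Bases. W - \<sigma>)"
  have finA: "finite A" unfolding A_def using finite_Bases finite_W by auto
  have neA: "\<exists>w\<in>W. c w \<noteq> 0" if "c \<in> A" for c
    using that unfolding A_def a_def by fastforce
  obtain \<omega> where \<omega>: "\<And>c. c \<in> A \<Longrightarrow> (\<Sum>w\<in>W. c w * \<omega> w) \<noteq> 0"
    by (rule exists_positive_generic_weight[OF finite_W finA neA]) (assumption, rule that)
  show ?thesis
  proof (rule that)
    fix \<sigma> w assume \<sigma>: "\<sigma> \<in> Bases" "w \<in> W - \<sigma>"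
    have "(\<Sum>v\<in>W. a (\<sigma>, w) v * \<omega> v) =
        (\<Sum>v\<in>W. if v \<in> \<sigma> then representation \<sigma> w v * \<omega> v else 0) - (\<Sum>v\<in>W. if v = w then \<omega> v else 0)"
      unfolding a_def sum_subtractf[symmetric] by (rule sum.cong) (auto simp: algebra_simps)
    also have "\<dots> = extend \<omega> \<sigma> w - \<omega> w"
      using \<sigma> finite_W Bases_subset[OF \<sigma>(1)]
      by (simp add: extend_def sum.inter_restrict[symmetric] Int_absorb1)
    finally show "extend \<omega> \<sigma> w \<noteq> \<omega> w"
      using \<omega>[of "a (\<sigma>, w)"] \<sigma> by (auto simp: A_def)
  qed
qed

lemma extend_lincomb:
  assumes "\<sigma> \<in> Bases" "A \<subseteq> W"
  shows "extend \<omega> \<sigma> (\<Sum>w\<in>A. c w *\<^sub>R w) = (\<Sum>w\<in>A. c w * extend \<omega> \<sigma> w)"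
proof -
  have "A \<subseteq> span W" using assms(2) span_superset by blast
  then have "extend \<omega> \<sigma> (\<Sum>w\<in>A. c w *\<^sub>R w) = (\<Sum>i\<in>\<sigma>. \<Sum>w\<in>A. c w * (representation \<sigma> w i * \<omega> i))"
    by (simp add: extend_def rep_lincomb assms sum_distrib_right mult.assoc)
  also have "\<dots> = (\<Sum>w\<in>A. c w * extend \<omega> \<sigma> w)"
    by (subst sum.swap) (simp add: extend_def sum_distrib_left)
  finally show ?thesis .
qed

lemma extend_basis_elem:
  assumes "\<sigma> \<in> Bases" "i \<in> \<sigma>"
  shows "extend \<omega> \<sigma> i = \<omega> i"
proof -
  have "extend \<omega> \<sigma> i = (\<Sum>j\<in>\<sigma>. if j = i then \<omega> j else 0)"
    unfolding extend_def by (rule sum.cong) (auto simp: rep_basis assms)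
  then show ?thesis using assms by (simp add: finite_basis)
qed

lemma Tri_extend_le:
  assumes "\<sigma> \<in> Tri \<omega>" "w \<in> W"
  shows "extend \<omega> \<sigma> w \<le> \<omega> w"
  using assms by (cases "w \<in> \<sigma>") (auto simp: Tri_def extend_basis_elem less_imp_le)

text \<open>On \<tau> the functional of \<sigma> is at most \<omega>, strictly so at an element
  outside \<sigma>, and \<open>y\<close> is a positive combination of \<tau>. Used in both
  directions, this shows that the interiors of two simplices of \<open>Tri\<close> are
  disjoint.\<close>

lemma Tri_less:
  assumes "\<sigma> \<in> Tri \<omega>" "\<tau> \<in> Bases" "\<sigma> \<noteq> \<tau>" "y \<in> span W"
    "\<And>i. i \<in> \<tau> \<Longrightarrow> representation \<tau> y i > 0"
  shows "extend \<omega> \<sigma> y < extend \<omega> \<tau> y"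
proof -
  have \<sigma>: "\<sigma> \<in> Bases" using assms(1) by (simp add: Tri_def)
  have "\<not> \<tau> \<subseteq> \<sigma>"
    using card_subset_eq[OF finite_basis[OF \<sigma>]] card_basis \<sigma> assms(2,3) by metis
  then obtain j where j: "j \<in> \<tau>" "j \<notin> \<sigma>" by blast
  have "extend \<omega> \<sigma> y = (\<Sum>i\<in>\<tau>. representation \<tau> y i * extend \<omega> \<sigma> i)"
    using extend_lincomb[OF \<sigma> Bases_subset[OF assms(2)]] sum_rep[OF assms(2,4)] by metis
  also have "\<dots> < (\<Sum>i\<in>\<tau>. representation \<tau> y i * \<omega> i)"
  proof (rule sum_strict_mono_ex1)
    show "\<forall>i\<in>\<tau>. representation \<tau> y i * extend \<omega> \<sigma> i \<le> representation \<tau> y i * \<omega> i"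
      using assms Bases_subset by (intro ballI mult_left_mono Tri_extend_le) (auto simp: less_imp_le)
    have "extend \<omega> \<sigma> j < \<omega> j" using j assms(1,2) Bases_subset by (auto simp: Tri_def)
    then show "\<exists>i\<in>\<tau>. representation \<tau> y i * extend \<omega> \<sigma> i < representation \<tau> y i * \<omega> i"
      using j assms(5) by auto
  qed (use assms finite_basis in auto)
  finally show ?thesis by (simp add: extend_def)
qed

text \<open>A simplex of minimal cost around \<open>y\<close> is dual feasible: otherwise a simplex-method pivot
  would decrease the cost. The heights make the pivot possible, since the coordinates of
  a generator sum up to 1.\<close>

lemma generic_in_Tri:
  assumes gen: "\<And>\<sigma> w. \<sigma> \<in> Bases \<Longrightarrow> w \<in> W - \<sigma> \<Longrightarrow> extend \<omega> \<sigma> w \<noteq> \<omega> w"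
    and y: "generic y" "y \<in> Cone"
  obtains \<sigma> where "\<sigma> \<in> Tri \<omega>" "\<And>i. i \<in> \<sigma> \<Longrightarrow> representation \<sigma> y i > 0"
proof -
  have yW: "y \<in> span W" using y(1) by (simp add: generic_def)
  define F where "F = {\<sigma>\<in>Bases. \<forall>i\<in>\<sigma>. representation \<sigma> y i > 0}"
  have "finite F" using finite_Bases by (simp add: F_def)
  obtain \<sigma>0 where "\<sigma>0 \<in> Bases" "\<And>i. i \<in> \<sigma>0 \<Longrightarrow> representation \<sigma>0 y i \<ge> 0"
    using Cone_in_simplicial_cone[OF y(2)] by blast
  then have "\<sigma>0 \<in> F" using y(1) by (auto simp: F_def generic_def order_less_le)
  then have "F \<noteq> {}" by auto
  then obtain \<sigma> where \<sigma>: "\<sigma> \<in> F" and min: "\<And>\<tau>. \<tau> \<in> F \<Longrightarrow> extend \<omega> \<sigma> y \<le> extend \<omega> \<tau> y"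
    using ex_min_if_finite[of "(\<lambda>\<sigma>. extend \<omega> \<sigma> y) ` F"] \<open>finite F\<close>
    by (metis (no_types, lifting) arg_min_if_finite(1) arg_min_least)
  have \<sigma>B: "\<sigma> \<in> Bases" and pos: "\<And>i. i \<in> \<sigma> \<Longrightarrow> representation \<sigma> y i > 0"
    using \<sigma> by (auto simp: F_def)
  have "extend \<omega> \<sigma> w < \<omega> w" if w: "w \<in> W - \<sigma>" for w
  proof (rule ccontr)
    assume "\<not> extend \<omega> \<sigma> w < \<omega> w"
    then have gt: "extend \<omega> \<sigma> w > \<omega> w" using gen[OF \<sigma>B w] by linarith
    define a where "a = representation \<sigma> w"
    define c where "c = representation \<sigma> y"
    have wspan: "w \<in> span W" using w span_base by blast
    have "(\<Sum>i\<in>\<sigma>. a i) = 1" using ht_rep[OF \<sigma>B wspan] ht_W w by (simp add: a_def)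
    then have "\<exists>i\<in>\<sigma>. a i > 0"
      by (metis not_less sum_nonpos zero_less_one)
    define R where "R = {i\<in>\<sigma>. a i > 0}"
    have R: "finite R" "R \<noteq> {}"
      using \<open>\<exists>i\<in>\<sigma>. a i > 0\<close> finite_basis[OF \<sigma>B] by (auto simp: R_def)
    \<comment> \<open>Ratio test: the largest multiple of \<open>w\<close> that can enter before a
      coordinate of \<open>y\<close> turns negative; \<open>j\<close> is the element that
      leaves.\<close>
    define \<theta> where "\<theta> = Min ((\<lambda>v. c v / a v) ` R)"
    obtain j where j: "j \<in> R" "\<theta> = c j / a j"
      using Min_in[of "(\<lambda>v. c v / a v) ` R"] R unfolding \<theta>_def
      by (metis (no_types, lifting) finite_imageI image_is_empty imageE)
    have \<theta>le: "\<theta> \<le> c v / a v" if "v \<in> R" for v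
      using that R unfolding \<theta>_def by auto
    have j\<sigma>: "j \<in> \<sigma>" "a j > 0" using j(1) by (auto simp: R_def)
    have \<theta>0: "\<theta> > 0" using j j\<sigma> pos by (simp add: c_def)
    have cge: "c v - \<theta> * a v \<ge> 0" if "v \<in> \<sigma>" for v
    proof (cases "a v > 0")
      case True
      then show ?thesis using \<theta>le[of v] that by (simp add: R_def field_simps)
    next
      case False
      then have "\<theta> * a v \<le> 0" using \<theta>0 by (simp add: mult_nonneg_nonpos)
      then show ?thesis using pos[OF that] by (simp add: c_def)
    qed
    define \<tau> where "\<tau> = insert w (\<sigma> - {j})"
    have \<tau>W: "\<tau> \<subseteq> W" using w Bases_subset[OF \<sigma>B] by (auto simp: \<tau>_def)
    have w_eq: "w = a j *\<^sub>R j + (\<Sum>i\<in>\<sigma>-{j}. a i *\<^sub>R i)"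
      using sum_rep[OF \<sigma>B wspan] sum.remove[OF finite_basis[OF \<sigma>B] j\<sigma>(1), of "\<lambda>i. a i *\<^sub>R i"]
      by (simp add: a_def)
    have "j = (1 / a j) *\<^sub>R (w - (\<Sum>i\<in>\<sigma>-{j}. a i *\<^sub>R i))"
      using j\<sigma>(2) by (subst w_eq) simp
    moreover have "\<dots> \<in> span \<tau>"
      by (intro span_scale span_diff span_sum) (auto intro: span_base simp: \<tau>_def)
    ultimately have "j \<in> span \<tau>" by simp
    then have "\<sigma> \<subseteq> span \<tau>" using span_superset[of \<tau>] by (auto simp: \<tau>_def)
    then have Wspan: "W \<subseteq> span \<tau>"
      by (metis \<sigma>B span_basis span_minimal span_superset subset_trans subspace_span)
    have fin\<tau>: "finite \<tau>" using \<tau>W finite_W finite_subset by blast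
    have card\<tau>: "card \<tau> = card \<sigma>"
      using w j\<sigma> finite_basis[OF \<sigma>B] by (simp add: \<tau>_def card_Diff_singleton card_gt_0_iff)
        (metis Suc_pred card_gt_0_iff empty_iff)
    \<comment> \<open>A spanning set of cardinality \<open>dim W\<close> is a basis.\<close>
    have "independent \<tau>"
    proof -
      obtain \<tau>' where \<tau>': "\<tau>' \<subseteq> \<tau>" "independent \<tau>'" "\<tau> \<subseteq> span \<tau>'"
        using maximal_independent_subset by blast
      then have "W \<subseteq> span \<tau>'" using Wspan by (metis span_minimal subset_trans subspace_span)
      then have "\<tau>' \<in> Bases" using \<tau>' \<tau>W by (auto simp: Bases_def)
      then have "card \<tau>' = card \<tau>" using card_basis \<sigma>B card\<tau> by simp
      then show ?thesis using \<tau>' card_subset_eq[OF fin\<tau>] by metis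
    qed
    then have \<tau>B: "\<tau> \<in> Bases" using \<tau>W Wspan by (simp add: Bases_def)
    define b where "b v = (if v = w then \<theta> else c v - \<theta> * a v)" for v
    have sumc: "y = c j *\<^sub>R j + (\<Sum>i\<in>\<sigma>-{j}. c i *\<^sub>R i)"
      using sum_rep[OF \<sigma>B yW] sum.remove[OF finite_basis[OF \<sigma>B] j\<sigma>(1), of "\<lambda>i. c i *\<^sub>R i"]
      by (simp add: c_def)
    have b: "b w = \<theta>" "\<And>v. v \<in> \<sigma> - {j} \<Longrightarrow> b v = c v - \<theta> * a v"
      using w by (auto simp: b_def)
    have cj: "c j = \<theta> * a j" using j j\<sigma> by simp
    have y_eq: "y = (\<Sum>v\<in>\<tau>. b v *\<^sub>R v)"
    proof -
      have "(\<Sum>v\<in>\<tau>. b v *\<^sub>R v) = \<theta> *\<^sub>R w + (\<Sum>v\<in>\<sigma>-{j}. (c v - \<theta> * a v) *\<^sub>R v)"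
        unfolding \<tau>_def using w finite_basis[OF \<sigma>B]
        by (subst sum.insert) (simp_all add: b)
      also have "(\<Sum>v\<in>\<sigma>-{j}. (c v - \<theta> * a v) *\<^sub>R v) =
          (\<Sum>v\<in>\<sigma>-{j}. c v *\<^sub>R v) - \<theta> *\<^sub>R (\<Sum>v\<in>\<sigma>-{j}. a v *\<^sub>R v)"
        by (simp add: scaleR_diff_left sum_subtractf scaleR_sum_right)
      also have "\<theta> *\<^sub>R w + \<dots> = y"
        by (subst w_eq, subst sumc) (simp add: cj algebra_simps)
      finally show ?thesis by simp
    qed
    have rep\<tau>: "representation \<tau> y v = b v" if "v \<in> \<tau>" for v
      using rep_basis_lincomb[OF \<tau>B that, of b] y_eq by simp
    have "representation \<tau> y v > 0" if "v \<in> \<tau>" for v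
    proof -
      have "b v \<ge> 0" using cge that \<theta>0 by (auto simp: b_def \<tau>_def)
      \<comment> \<open>Genericity excludes degenerate pivots: no coordinate becomes zero in the new
        basis, so \<tau> competes in \<open>F\<close>.\<close>
      moreover have "representation \<tau> y v \<noteq> 0" using y(1) \<tau>B that by (auto simp: generic_def)
      ultimately show ?thesis using rep\<tau>[OF that] by simp
    qed
    then have "\<tau> \<in> F" using \<tau>B by (simp add: F_def)
    have "extend \<omega> \<tau> y = (\<Sum>v\<in>\<tau>. b v * \<omega> v)"
      unfolding extend_def by (rule sum.cong) (auto simp: rep\<tau>)
    also have "\<dots> = \<theta> * \<omega> w + (\<Sum>v\<in>\<sigma>-{j}. (c v - \<theta> * a v) * \<omega> v)"
      unfolding \<tau>_def using w finite_basis[OF \<sigma>B]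
      by (subst sum.insert) (simp_all add: b)
    also have "(\<Sum>v\<in>\<sigma>-{j}. (c v - \<theta> * a v) * \<omega> v) = (\<Sum>v\<in>\<sigma>. (c v - \<theta> * a v) * \<omega> v)"
      using sum.remove[OF finite_basis[OF \<sigma>B] j\<sigma>(1), of "\<lambda>v. (c v - \<theta> * a v) * \<omega> v"] cj by simp
    also have "\<dots> = extend \<omega> \<sigma> y - \<theta> * extend \<omega> \<sigma> w"
      by (simp add: extend_def c_def a_def algebra_simps sum_subtractf sum_distrib_left)
    \<comment> \<open>The second factor is the reduced cost of \<open>w\<close>, negative by
      \<open>gt\<close>.\<close>
    finally have "extend \<omega> \<tau> y - extend \<omega> \<sigma> y = \<theta> * (\<omega> w - extend \<omega> \<sigma> w)"
      by (simp add: algebra_simps)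
    also have "\<dots> < 0" using \<theta>0 gt by (simp add: mult_pos_neg)
    finally show False using min[OF \<open>\<tau> \<in> F\<close>] by simp
  qed
  then show ?thesis using that \<sigma>B pos by (auto simp: Tri_def)
qed

section \<open>Half-open simplicial cones along a generic interior direction\<close>

lemma exists_generic_interior:
  obtains \<omega> where "\<And>w. \<omega> w > 0" "generic (\<Sum>w\<in>W. \<omega> w *\<^sub>R w)"
proof -
  define a :: "'b set \<times> 'b \<Rightarrow> 'b \<Rightarrow> real" where "a = (\<lambda>(\<sigma>, i) v. representation \<sigma> v i)"
  define A where "A = a ` (SIGMA \<sigma>:Bases. \<sigma>)"
  have finA: "finite A" unfolding A_def using finite_Bases finite_basis by auto
  have neA: "\<exists>w\<in>W. c w \<noteq> 0" if c: "c \<in> A" for c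
  proof -
    obtain \<sigma> i where \<sigma>: "\<sigma> \<in> Bases" "i \<in> \<sigma>" "c = a (\<sigma>, i)" using c by (auto simp: A_def)
    \<comment> \<open>The coordinate of \<open>i\<close> at itself is 1, so none of the conditions
      to be avoided is trivial.\<close>
    then have "c i = 1" "i \<in> W" using Bases_subset by (auto simp: a_def rep_basis)
    then show ?thesis by (metis zero_neq_one)
  qed
  obtain \<omega> where \<omega>: "\<And>w. \<omega> w > 0" "\<And>c. c \<in> A \<Longrightarrow> (\<Sum>w\<in>W. c w * \<omega> w) \<noteq> 0"
    by (rule exists_positive_generic_weight[OF finite_W finA neA]) (assumption, rule that)
  have "representation \<sigma> (\<Sum>w\<in>W. \<omega> w *\<^sub>R w) i \<noteq> 0" if "\<sigma> \<in> Bases" "i \<in> \<sigma>" for \<sigma> i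
  proof -
    have "a (\<sigma>, i) \<in> A" using that unfolding A_def by blast
    then show ?thesis using \<omega>(2)[of "a (\<sigma>, i)"] rep_lincomb[OF that(1) span_superset, of \<omega> i]
      by (simp add: a_def mult.commute)
  qed
  then show ?thesis using that[of \<omega>] \<omega>(1) by (simp add: generic_def lincomb_in_span)
qed

definition half_open :: "'b \<Rightarrow> 'b set \<Rightarrow> 'b \<Rightarrow> bool"
  where "half_open q \<sigma> y \<longleftrightarrow> (\<forall>i\<in>\<sigma>. sign_pos (representation \<sigma> y i) (representation \<sigma> q i))"

text \<open>The simplex containing \<open>y + \<epsilon> q\<close> for all small \<open>\<epsilon>\<close>.\<close>

lemma half_open_unique:
  assumes gen: "\<And>\<sigma> w. \<sigma> \<in> Bases \<Longrightarrow> w \<in> W - \<sigma> \<Longrightarrow> extend \<omega> \<sigma> w \<noteq> \<omega> w"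
    and q: "generic q" and y: "y \<in> span W" and ev: "\<forall>\<^sub>F \<epsilon> in at_right 0. y + \<epsilon> *\<^sub>R q \<in> Cone"
  shows "\<exists>!\<sigma>. \<sigma> \<in> Tri \<omega> \<and> half_open q \<sigma> y"
proof -
  have qW: "q \<in> span W" using q by (simp add: generic_def)
  define r where "r \<epsilon> \<sigma> i = representation \<sigma> (y + \<epsilon> *\<^sub>R q) i" for \<epsilon> \<sigma> i
  have r: "r \<epsilon> \<sigma> i = representation \<sigma> y i + \<epsilon> * representation \<sigma> q i" if "\<sigma> \<in> Bases" for \<epsilon> \<sigma> i
    using that y qW by (simp add: r_def rep_add rep_scale span_scale)
  have "\<forall>\<^sub>F \<epsilon> in at_right 0. \<forall>\<sigma>\<in>Bases. \<forall>i\<in>\<sigma>. r \<epsilon> \<sigma> i \<noteq> 0 \<and>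
      (r \<epsilon> \<sigma> i > 0 \<longleftrightarrow> sign_pos (representation \<sigma> y i) (representation \<sigma> q i))"
  proof (intro eventually_ball_finite finite_Bases finite_basis ballI)
    fix \<sigma> i assume "\<sigma> \<in> Bases" "i \<in> \<sigma>"
    then show "\<forall>\<^sub>F \<epsilon> in at_right 0. r \<epsilon> \<sigma> i \<noteq> 0 \<and>
        (r \<epsilon> \<sigma> i > 0 \<longleftrightarrow> sign_pos (representation \<sigma> y i) (representation \<sigma> q i))"
      using q eventually_sign_pos by (simp add: r generic_def)
  qed
  then have "\<forall>\<^sub>F \<epsilon> in at_right 0. y + \<epsilon> *\<^sub>R q \<in> Cone \<and> (\<forall>\<sigma>\<in>Bases. \<forall>i\<in>\<sigma>. r \<epsilon> \<sigma> i \<noteq> 0 \<and>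
      (r \<epsilon> \<sigma> i > 0 \<longleftrightarrow> sign_pos (representation \<sigma> y i) (representation \<sigma> q i)))"
    using ev by eventually_elim blast
  then obtain \<epsilon> where \<epsilon>: "y + \<epsilon> *\<^sub>R q \<in> Cone" and nz: "\<And>\<sigma> i. \<sigma> \<in> Bases \<Longrightarrow> i \<in> \<sigma> \<Longrightarrow> r \<epsilon> \<sigma> i \<noteq> 0"
    and sg: "\<And>\<sigma> i. \<sigma> \<in> Bases \<Longrightarrow> i \<in> \<sigma> \<Longrightarrow>
      r \<epsilon> \<sigma> i > 0 \<longleftrightarrow> sign_pos (representation \<sigma> y i) (representation \<sigma> q i)"
    using eventually_happens[of _ "at_right (0::real)"] by force
  \<comment> \<open>One small \<epsilon> settles all the finitely many signs at once, and the
    perturbed point lies on no wall.\<close>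
  define z where "z = y + \<epsilon> *\<^sub>R q"
  have z: "generic z" "z \<in> Cone"
    using nz \<epsilon> y qW by (auto simp: generic_def z_def r_def span_add span_scale)
  have iff: "half_open q \<sigma> y \<longleftrightarrow> (\<forall>i\<in>\<sigma>. representation \<sigma> z i > 0)" if "\<sigma> \<in> Bases" for \<sigma>
    using sg[OF that] by (auto simp: half_open_def z_def r_def)
  obtain \<sigma> where \<sigma>: "\<sigma> \<in> Tri \<omega>" "\<And>i. i \<in> \<sigma> \<Longrightarrow> representation \<sigma> z i > 0"
    using generic_in_Tri[OF gen z] by blast
  show ?thesis
  proof (intro ex1I[of _ \<sigma>] conjI)
    show "half_open q \<sigma> y" using \<sigma> iff by (simp add: Tri_def)
    fix \<tau> assume \<tau>: "\<tau> \<in> Tri \<omega> \<and> half_open q \<tau> y"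
    have B: "\<sigma> \<in> Bases" "\<tau> \<in> Bases" using \<sigma> \<tau> by (auto simp: Tri_def)
    show "\<tau> = \<sigma>"
    proof (rule ccontr)
      assume "\<tau> \<noteq> \<sigma>"
      moreover have "z \<in> span W" using z(1) by (simp add: generic_def)
      ultimately show False
        using Tri_less[of \<sigma> \<omega> \<tau> z] Tri_less[of \<tau> \<omega> \<sigma> z] \<sigma> \<tau> B iff by fastforce
    qed
  qed (use \<sigma> in auto)
qed

end

section \<open>The numerator of the Ehrhart series\<close>

text \<open>Rounding for the reflection of an interior point. The value \<open>of_int c - a\<close>
  falls into [0, 1) if \<open>b\<close> is positive and into (0, 1] if it is negative; in both cases
  the opposite rule for \<open>a\<close> forces \<open>c \<ge> 1\<close>, which later bounds the
  heights.\<close>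

lemma exists_half_open_ceiling:
  fixes a b :: real
  assumes "sign_pos a (- b)" "b \<noteq> 0"
  obtains c :: int where "c \<ge> 1" "sign_pos (of_int c - a) b" "\<not> sign_pos (of_int c - a - 1) b"
proof (cases "b > 0")
  case True
  then have "a > 0" using assms by (auto simp: sign_pos_def)
  show ?thesis
  proof (rule that[of "\<lceil>a\<rceil>"])
    show "\<lceil>a\<rceil> \<ge> 1" using \<open>a > 0\<close> by linarith
    show "sign_pos (of_int \<lceil>a\<rceil> - a) b" using True unfolding sign_pos_def by linarith
    show "\<not> sign_pos (of_int \<lceil>a\<rceil> - a - 1) b" unfolding sign_pos_def by linarith
  qed
next
  case False
  then have "a \<ge> 0" "b < 0" using assms by (auto simp: sign_pos_def)
  show ?thesis
  proof (rule that[of "\<lfloor>a\<rfloor> + 1"])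
    show "\<lfloor>a\<rfloor> + 1 \<ge> 1" using \<open>a \<ge> 0\<close> by linarith
    show "sign_pos (of_int (\<lfloor>a\<rfloor> + 1) - a) b" unfolding sign_pos_def by linarith
    show "\<not> sign_pos (of_int (\<lfloor>a\<rfloor> + 1) - a - 1) b" using \<open>b < 0\<close> unfolding sign_pos_def by linarith
  qed
qed

text \<open>Discreteness of the lattice enters as \<open>finite_level\<close>, so that all counts
  below are counts of finite sets.\<close>

locale graded_lattice = graded_generators W ht for W :: "'b::real_vector set" and ht +
  fixes L :: "'b set"
  assumes L_zero: "0 \<in> L" and L_diff: "x \<in> L \<Longrightarrow> y \<in> L \<Longrightarrow> x - y \<in> L"
    and W_subset_L: "W \<subseteq> L" and ht_L: "y \<in> L \<Longrightarrow> ht y \<in> \<int>"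
    and finite_level: "finite {y \<in> L \<inter> Cone. ht y = real k}"
begin

lemma ht_nat:
  assumes "y \<in> L" "y \<in> Cone"
  obtains m where "ht y = real m"
  using ht_L[OF assms(1)] ht_Cone_nonneg[OF assms(2)]
  by (metis Ints_cases nonneg_int_cases of_int_0_le_iff of_int_of_nat_eq)

lemma L_uminus: "y \<in> L \<Longrightarrow> - y \<in> L"
  using L_diff[OF L_zero] by simp

lemma L_add: "x \<in> L \<Longrightarrow> y \<in> L \<Longrightarrow> x + y \<in> L"
  using L_diff[OF _ L_uminus, of x y] by simp

lemma L_sum: "(\<And>i. i \<in> A \<Longrightarrow> f i \<in> L) \<Longrightarrow> sum f A \<in> L"
  by (induction A rule: infinite_finite_induct) (auto simp: L_zero L_add)

lemma L_scale_nat: "y \<in> L \<Longrightarrow> real m *\<^sub>R y \<in> L"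
  by (induction m) (auto simp: L_zero L_add scaleR_left_distrib)

lemma L_scale_int: "y \<in> L \<Longrightarrow> of_int m *\<^sub>R y \<in> L"
  by (cases m rule: int_cases2) (auto simp: L_scale_nat L_uminus)

lemma L_int_lincomb: "A \<subseteq> W \<Longrightarrow> (\<Sum>w\<in>A. of_int (c w) *\<^sub>R w) \<in> L"
  using W_subset_L by (intro L_sum L_scale_int) auto

section \<open>Series of half-open cones and of their parallelepipeds\<close>

definition count :: "nat \<Rightarrow> nat"
  where "count k = card {y \<in> L \<inter> Cone. ht y = real k}"

text \<open>For \<open>S = {}\<close> this is the height \<open>k\<close> part of the half-open
  cone, for \<open>S = \<sigma>\<close> that of its half-open parallelepiped. The sets in between
  allow an induction over one generator at a time.\<close>

definition cell :: "'b \<Rightarrow> 'b set \<Rightarrow> 'b set \<Rightarrow> nat \<Rightarrow> 'b set"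
  where "cell q \<sigma> S k = {y \<in> L \<inter> span W. half_open q \<sigma> y \<and> ht y = real k \<and>
    (\<forall>i\<in>S. \<not> sign_pos (representation \<sigma> y i - 1) (representation \<sigma> q i))}"

lemma half_open_imp_Cone:
  assumes "\<sigma> \<in> Bases" "y \<in> span W" "half_open q \<sigma> y"
  shows "y \<in> Cone"
  by (rule Cone_if_rep_nonneg[OF assms(1,2)]) (use assms(3) in \<open>auto simp: half_open_def sign_pos_def\<close>)

lemma finite_cell:
  assumes "\<sigma> \<in> Bases"
  shows "finite (cell q \<sigma> S k)"
  by (rule finite_subset[OF _ finite_level[of k]])
    (auto simp: cell_def intro: half_open_imp_Cone[OF assms])

lemma half_open_shift:
  assumes "\<sigma> \<in> Bases" "i \<in> \<sigma>" "y \<in> span W"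
  shows "half_open q \<sigma> (y - i) \<longleftrightarrow>
    half_open q \<sigma> y \<and> sign_pos (representation \<sigma> y i - 1) (representation \<sigma> q i)"
proof -
  have r: "representation \<sigma> (y - i) j = representation \<sigma> y j - (if j = i then 1 else 0)" for j
    using assms Bases_subset span_base by (subst rep_diff) (auto simp: rep_basis)
  have "sign_pos (representation \<sigma> y i - 1) b \<Longrightarrow> sign_pos (representation \<sigma> y i) b" for b
    by (auto simp: sign_pos_def)
  then show ?thesis using assms(2) unfolding half_open_def r by (auto split: if_splits)
qed

text \<open>The points whose \<open>i\<close>-th coordinate is too large for the unit interval are
  the translates by \<open>i\<close> of the points one level lower. So confining one more coordinate
  multiplies the series by \<open>1 - fps_X\<close>.\<close>

lemma card_cell_insert:
  assumes "\<sigma> \<in> Bases" "S \<subseteq> \<sigma>" "i \<in> \<sigma>" "i \<notin> S"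
  shows "card (cell q \<sigma> S k) =
    card (cell q \<sigma> (insert i S) k) + (if k = 0 then 0 else card (cell q \<sigma> S (k - 1)))"
proof -
  have iW: "i \<in> W" "i \<in> L" "i \<in> span W" using assms Bases_subset W_subset_L span_base by blast+
  define D where
    "D = {y \<in> cell q \<sigma> S k. sign_pos (representation \<sigma> y i - 1) (representation \<sigma> q i)}"
  have split: "cell q \<sigma> S k = cell q \<sigma> (insert i S) k \<union> D"
    by (auto simp: D_def cell_def)
  have disj: "cell q \<sigma> (insert i S) k \<inter> D = {}"
    by (auto simp: D_def cell_def)
  have "finite D" using finite_cell[OF assms(1)] by (simp add: D_def)
  then have card: "card (cell q \<sigma> S k) = card (cell q \<sigma> (insert i S) k) + card D"
    unfolding split by (intro card_Un_disjoint finite_cell assms disj)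
  have ht_shift: "ht (y - i) = ht y - 1" for y
    using iW by (simp add: linear_diff[OF linear_ht] ht_W)
  have D_iff: "y \<in> D \<longleftrightarrow> y \<in> L \<inter> span W \<and> half_open q \<sigma> (y - i) \<and> ht y = real k \<and>
      (\<forall>j\<in>S. \<not> sign_pos (representation \<sigma> y j - 1) (representation \<sigma> q j))" for y
    using half_open_shift[OF assms(1,3)] by (auto simp: D_def cell_def)
  show ?thesis
  proof (cases "k = 0")
    case True
    \<comment> \<open>At height 0 the translated point would lie in the cone at height -1.\<close>
    have "D = {}"
    proof (rule ccontr)
      assume "D \<noteq> {}"
      then obtain y where "y \<in> D" by blast
      then have "y - i \<in> Cone" "ht y = 0"
        using half_open_imp_Cone[OF assms(1)] iW True unfolding D_iff by (auto intro: span_diff)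
      then show False using ht_Cone_nonneg[of "y - i"] ht_shift[of y] by simp
    qed
    then show ?thesis using card True by simp
  next
    case False
    have rep: "representation \<sigma> (y - i) j = representation \<sigma> y j" if "y \<in> span W" "j \<in> S" for y j
      using that assms iW by (subst rep_diff) (auto simp: rep_basis)
    have "bij_betw (\<lambda>y. y - i) D (cell q \<sigma> S (k - 1))"
    proof (rule bij_betw_byWitness[where f' = "\<lambda>y. y + i"])
      show "(\<lambda>y. y - i) ` D \<subseteq> cell q \<sigma> S (k - 1)"
        using iW False by (auto simp: D_iff cell_def ht_shift rep intro: L_diff span_diff)
      show "(\<lambda>y. y + i) ` cell q \<sigma> S (k - 1) \<subseteq> D"
      proof safe
        fix y assume y: "y \<in> cell q \<sigma> S (k - 1)"
        then have "y + i \<in> span W" using iW by (auto simp: cell_def intro: span_add)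
        moreover have "ht (y + i) = real k"
          using ht_shift[of "y + i"] y False by (simp add: cell_def)
        ultimately show "y + i \<in> D"
          using y iW rep[of "y + i"] by (auto simp: D_iff cell_def intro: L_add)
      qed
    qed auto
    then show ?thesis using card False by (simp add: bij_betw_same_card)
  qed
qed

lemma cell_series:
  assumes "\<sigma> \<in> Bases" "S \<subseteq> \<sigma>"
  shows "Abs_fps (\<lambda>k. int (card (cell q \<sigma> S k))) =
    Abs_fps (\<lambda>k. int (card (cell q \<sigma> {} k))) * (1 - fps_X) ^ card S"
proof -
  have "finite S" using assms finite_basis finite_subset by blast
  then show ?thesis using assms(2)
  proof (induction S rule: finite_induct)
    case (insert i S)
    have "Abs_fps (\<lambda>k. int (card (cell q \<sigma> (insert i S) k))) =
        Abs_fps (\<lambda>k. int (card (cell q \<sigma> S k))) * (1 - fps_X)"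
    proof (rule fps_ext)
      fix k
      show "fps_nth (Abs_fps (\<lambda>k. int (card (cell q \<sigma> (insert i S) k)))) k =
          fps_nth (Abs_fps (\<lambda>k. int (card (cell q \<sigma> S k))) * (1 - fps_X)) k"
        using card_cell_insert[OF assms(1), of S i q k] insert.hyps insert.prems
        by (simp add: right_diff_distrib fps_mult_fps_X_commute[symmetric])
    qed
    then show ?case using insert by (simp add: mult_ac)
  qed simp
qed

text \<open>The reason why the numerator is a polynomial: coordinates in the parallelepiped are at
  most 1, and their sum is the height.\<close>

lemma cell_full_bound:
  assumes "\<sigma> \<in> Bases" "y \<in> cell q \<sigma> \<sigma> k"
  shows "k \<le> dim W"
proof -
  have "ht y = (\<Sum>i\<in>\<sigma>. representation \<sigma> y i)" using ht_rep[OF assms(1), of y] assms(2) by (simp add: cell_def)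
  also have "\<dots> \<le> (\<Sum>i\<in>\<sigma>. 1)"
    using assms(2) by (intro sum_mono) (force simp: cell_def sign_pos_def)
  finally show ?thesis using assms card_basis by (simp add: cell_def)
qed

text \<open>Positive coefficients at all generators express that \<open>x\<close> is in the relative
  interior of the cone. The least height of such a lattice point is the codegree, so the condition
  says that \<open>dim W\<close> minus the codegree is at most \<open>d\<close>.\<close>

definition degree_bound :: "nat \<Rightarrow> bool"
  where "degree_bound d \<longleftrightarrow> (\<forall>x\<in>L. \<forall>\<mu>. (\<forall>w\<in>W. \<mu> w > 0) \<longrightarrow> x = (\<Sum>w\<in>W. \<mu> w *\<^sub>R w) \<longrightarrow>
    real (dim W) - ht x \<le> real d)"

text \<open>Half-open decomposition: the triangulation splits the lattice points of the cone into
  half-open simplicial cones, whose series have the numerators \<open>\<Sum>k. card (cell q \<sigma> \<sigma> k) t^k\<close>.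
  Reflecting an interior point of height \<open>k\<close> into the box of its simplex yields a box point of
  height at least \<open>dim W - k\<close>; this is the part of Ehrhart reciprocity needed here.\<close>

theorem numerator_exists:
  obtains h :: "int poly"
  where "fps_of_poly h = Abs_fps (\<lambda>k. int (count k)) * (1 - fps_X) ^ dim W"
    and "degree_bound (degree h)"
proof -
  obtain \<omega> where gen: "\<And>\<sigma> w. \<sigma> \<in> Bases \<Longrightarrow> w \<in> W - \<sigma> \<Longrightarrow> extend \<omega> \<sigma> w \<noteq> \<omega> w"
    by (rule exists_generic_heights) (rule that)
  obtain \<nu> where \<nu>: "\<And>w. \<nu> w > 0" "generic (\<Sum>w\<in>W. \<nu> w *\<^sub>R w)"
    by (rule exists_generic_interior) (rule that)
  define q where "q = (\<Sum>w\<in>W. \<nu> w *\<^sub>R w)"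
  have q: "generic q" "q \<in> Cone" "q \<in> span W"
    using \<nu> ConeI[of W \<nu>] by (auto simp: q_def less_imp_le lincomb_in_span)
  have qneg: "generic (- q)"
    using q Bases_independent span_basis
    by (auto simp: generic_def real_vector.representation_neg span_neg)
  have TB: "\<sigma> \<in> Bases" if "\<sigma> \<in> Tri \<omega>" for \<sigma> using that by (simp add: Tri_def)
  have finT: "finite (Tri \<omega>)" using finite_Bases by (simp add: Tri_def)
  have uniq: "\<exists>!\<sigma>. \<sigma> \<in> Tri \<omega> \<and> half_open q \<sigma> y" if "y \<in> Cone" for y
  proof (rule half_open_unique[OF gen q(1)])
    show "\<forall>\<^sub>F \<epsilon> in at_right 0. y + \<epsilon> *\<^sub>R q \<in> Cone"
      using that q by (intro eventually_at_rightI[of 0 1]) (auto intro!: Cone_add Cone_scale)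
  qed (use that Cone_subset_span in auto)
  have count: "count k = (\<Sum>\<sigma>\<in>Tri \<omega>. card (cell q \<sigma> {} k))" for k
  proof -
    have "{y \<in> L \<inter> Cone. ht y = real k} = (\<Union>\<sigma>\<in>Tri \<omega>. cell q \<sigma> {} k)"
    proof safe
      fix y assume y: "y \<in> L" "y \<in> Cone" "ht y = real k"
      then show "y \<in> (\<Union>\<sigma>\<in>Tri \<omega>. cell q \<sigma> {} k)"
        using uniq[OF y(2)] Cone_subset_span by (auto simp: cell_def)
    qed (auto simp: cell_def intro: half_open_imp_Cone[OF TB])
    moreover have "\<forall>\<sigma>\<in>Tri \<omega>. \<forall>\<tau>\<in>Tri \<omega>. \<sigma> \<noteq> \<tau> \<longrightarrow> cell q \<sigma> {} k \<inter> cell q \<tau> {} k = {}"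
    proof (intro ballI impI equals0I)
      fix \<sigma> \<tau> y
      assume *: "\<sigma> \<in> Tri \<omega>" "\<tau> \<in> Tri \<omega>" "\<sigma> \<noteq> \<tau>" "y \<in> cell q \<sigma> {} k \<inter> cell q \<tau> {} k"
      then have "y \<in> Cone" using half_open_imp_Cone[OF TB, of \<sigma> y q] by (simp add: cell_def)
      then show False using uniq[of y] * by (auto simp: cell_def)
    qed
    ultimately show ?thesis
      unfolding count_def by (simp add: card_UN_disjoint finT finite_cell TB)
  qed
  \<comment> \<open>Cutting off at \<open>dim W\<close> loses nothing, by
    \<open>cell_full_bound\<close>.\<close>
  define h where "h = (\<Sum>\<sigma>\<in>Tri \<omega>. \<Sum>k\<le>dim W. monom (int (card (cell q \<sigma> \<sigma> k))) k)"
  have coeff_h: "coeff h k = (\<Sum>\<sigma>\<in>Tri \<omega>. int (card (cell q \<sigma> \<sigma> k)))" for k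
  proof -
    have "(\<Sum>j\<le>dim W. coeff (monom (int (card (cell q \<sigma> \<sigma> j))) j) k) = int (card (cell q \<sigma> \<sigma> k))"
      if "\<sigma> \<in> Tri \<omega>" for \<sigma>
    proof (cases "k \<le> dim W")
      case False
      then have "cell q \<sigma> \<sigma> k = {}" using cell_full_bound[OF TB[OF that]] by auto
      then show ?thesis using False by (simp add: coeff_monom sum.delta)
    qed (simp add: coeff_monom sum.delta)
    then show ?thesis by (simp add: h_def coeff_sum)
  qed
  show ?thesis
  proof (rule that[of h])
    have "fps_of_poly h = (\<Sum>\<sigma>\<in>Tri \<omega>. Abs_fps (\<lambda>k. int (card (cell q \<sigma> \<sigma> k))))"
      by (rule fps_ext) (simp add: coeff_h fps_sum_nth)
    also have "\<dots> = (\<Sum>\<sigma>\<in>Tri \<omega>. Abs_fps (\<lambda>k. int (card (cell q \<sigma> {} k))) * (1 - fps_X) ^ dim W)"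
      using cell_series[OF TB order_refl] TB card_basis by (intro sum.cong) auto
    also have "\<dots> = (\<Sum>\<sigma>\<in>Tri \<omega>. Abs_fps (\<lambda>k. int (card (cell q \<sigma> {} k)))) * (1 - fps_X) ^ dim W"
      by (simp add: sum_distrib_right)
    also have "(\<Sum>\<sigma>\<in>Tri \<omega>. Abs_fps (\<lambda>k. int (card (cell q \<sigma> {} k)))) = Abs_fps (\<lambda>k. int (count k))"
      by (rule fps_ext) (simp add: count fps_sum_nth)
    finally show "fps_of_poly h = Abs_fps (\<lambda>k. int (count k)) * (1 - fps_X) ^ dim W" .
  next
    show "degree_bound (degree h)"
      unfolding degree_bound_def
    proof (intro ballI allI impI)
      fix x \<mu> assume x: "x \<in> L" "x = (\<Sum>w\<in>W. \<mu> w *\<^sub>R w)" and \<mu>: "\<forall>w\<in>W. \<mu> w > 0"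
      have xW: "x \<in> span W" using x(2) by (simp add: lincomb_in_span)
      \<comment> \<open>Being interior, \<open>x\<close> stays in the cone when pushed along
        \<open>- q\<close>. This places it in a simplex that is half-open in the way opposite to
        \<open>q\<close>.\<close>
      have "\<forall>\<^sub>F \<epsilon> in at_right 0. \<forall>w\<in>W. \<mu> w - \<epsilon> * \<nu> w > 0"
      proof (intro eventually_ball_finite finite_W ballI)
        fix w assume "w \<in> W"
        then have "\<forall>\<^sub>F \<epsilon> in at_right 0. \<mu> w + \<epsilon> * - \<nu> w > 0"
          using eventually_sign_pos[of "- \<nu> w" "\<mu> w"] \<nu>(1)[of w] \<mu> \<open>w \<in> W\<close>
          by (auto simp: sign_pos_def elim: eventually_mono)
        then show "\<forall>\<^sub>F \<epsilon> in at_right 0. \<mu> w - \<epsilon> * \<nu> w > 0" by simp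
      qed
      then have "\<forall>\<^sub>F \<epsilon> in at_right 0. x + \<epsilon> *\<^sub>R - q \<in> Cone"
      proof eventually_elim
        case (elim \<epsilon>)
        have "x + \<epsilon> *\<^sub>R - q = (\<Sum>w\<in>W. (\<mu> w - \<epsilon> * \<nu> w) *\<^sub>R w)"
          by (simp add: x(2) q_def scaleR_diff_left sum_subtractf scaleR_sum_right)
        then show ?case using elim ConeI[of W "\<lambda>w. \<mu> w - \<epsilon> * \<nu> w"] by (simp add: less_imp_le)
      qed
      then obtain \<sigma> where \<sigma>: "\<sigma> \<in> Tri \<omega>" "half_open (- q) \<sigma> x"
        using half_open_unique[OF gen qneg xW] by blast
      have \<sigma>B: "\<sigma> \<in> Bases" by (rule TB[OF \<sigma>(1)])
      have negrep: "representation \<sigma> (- q) i = - representation \<sigma> q i" for i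
        using q(3) \<sigma>B by (simp add: real_vector.representation_neg Bases_independent span_basis)
      have "\<exists>c::int. c \<ge> 1 \<and> sign_pos (of_int c - representation \<sigma> x i) (representation \<sigma> q i) \<and>
          \<not> sign_pos (of_int c - representation \<sigma> x i - 1) (representation \<sigma> q i)" if "i \<in> \<sigma>" for i
      proof (rule exists_half_open_ceiling)
        show "sign_pos (representation \<sigma> x i) (- representation \<sigma> q i)"
          using \<sigma>(2) that by (simp add: half_open_def negrep)
        show "representation \<sigma> q i \<noteq> 0" using q(1) \<sigma>B that by (auto simp: generic_def)
      qed blast
      then obtain c :: "'b \<Rightarrow> int" where c: "\<And>i. i \<in> \<sigma> \<Longrightarrow> c i \<ge> 1"
        "\<And>i. i \<in> \<sigma> \<Longrightarrow> sign_pos (of_int (c i) - representation \<sigma> x i) (representation \<sigma> q i)"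
        "\<And>i. i \<in> \<sigma> \<Longrightarrow> \<not> sign_pos (of_int (c i) - representation \<sigma> x i - 1) (representation \<sigma> q i)"
        by metis
      \<comment> \<open>Reflection within the simplex: negation exchanges the rules for
        \<open>- q\<close> and \<open>q\<close>, and the choice of \<open>c\<close> puts every
        coordinate into the unit interval of the cell for \<open>q\<close>.\<close>
      define z where "z = (\<Sum>i\<in>\<sigma>. of_int (c i) *\<^sub>R i) - x"
      have \<sigma>W: "\<sigma> \<subseteq> W" by (rule Bases_subset[OF \<sigma>B])
      have sL: "(\<Sum>i\<in>\<sigma>. of_int (c i) *\<^sub>R i) \<in> L" "(\<Sum>i\<in>\<sigma>. of_int (c i) *\<^sub>R i) \<in> span W"
        using L_int_lincomb[OF \<sigma>W] lincomb_in_span[OF \<sigma>W] by auto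
      have zL: "z \<in> L" "z \<in> span W" using sL x(1) xW by (auto simp: z_def intro: L_diff span_diff)
      have rz: "representation \<sigma> z i = of_int (c i) - representation \<sigma> x i" if "i \<in> \<sigma>" for i
        using rep_basis_lincomb[OF \<sigma>B that, of "\<lambda>i. of_int (c i)"] \<sigma>B sL xW by (simp add: z_def rep_diff)
      have ho: "half_open q \<sigma> z" using c(2) rz by (simp add: half_open_def)
      have "z \<in> Cone" by (rule half_open_imp_Cone[OF \<sigma>B zL(2) ho])
      then obtain m where m: "ht z = real m" using ht_nat[OF zL(1)] by blast
      have "z \<in> cell q \<sigma> \<sigma> m" using zL ho m c(3) rz by (simp add: cell_def)
      then have "card (cell q \<sigma> \<sigma> m) > 0" using finite_cell[OF \<sigma>B] card_gt_0_iff by blast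
      \<comment> \<open>The other simplices contribute cardinalities as well, so nothing cancels
        \<open>z\<close>.\<close>
      then have "coeff h m > 0"
        unfolding coeff_h using \<sigma>(1) by (intro sum_pos2[OF finT, of \<sigma>]) auto
      then have "m \<le> degree h" by (intro le_degree) simp
      have "real (dim W) = (\<Sum>i\<in>\<sigma>. 1)" using card_basis[OF \<sigma>B] by simp
      also have "\<dots> \<le> (\<Sum>i\<in>\<sigma>. of_int (c i))" using c(1) by (intro sum_mono) auto
      also have "\<dots> = ht z + ht x"
        using ht_lincomb[OF \<sigma>W, of "\<lambda>i. of_int (c i)"] by (simp add: z_def linear_diff[OF linear_ht])
      finally show "real (dim W) - ht x \<le> real (degree h)" using m \<open>m \<le> degree h\<close> by simp
    qed
  qed
qed

section \<open>Existence of an apex\<close>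

text \<open>Positive coefficients on a spanning subset already mean interior: write the sum of all
  generators in terms of \<open>S\<close>, take a small multiple of it away from the coefficients,
  and add it back spread over all of \<open>W\<close>.\<close>

lemma degree_bound_subset:
  assumes d: "degree_bound d" and S: "S \<subseteq> W" "W \<subseteq> span S"
    and x: "x \<in> L" "x = (\<Sum>s\<in>S. c s *\<^sub>R s)" and c: "\<And>s. s \<in> S \<Longrightarrow> c s > 0"
  shows "real (dim W) - ht x \<le> real d"
proof -
  have finS: "finite S" using S finite_W finite_subset by blast
  have "(\<Sum>w\<in>W. w) \<in> span S" using S by (intro span_sum) auto
  then obtain a where a: "(\<Sum>w\<in>W. w) = (\<Sum>s\<in>S. a s *\<^sub>R s)"
    by (auto simp: span_finite[OF finS])
  have "\<forall>\<^sub>F \<epsilon> in at_right (0::real). \<forall>s\<in>S. c s - \<epsilon> * a s > 0"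
  proof (intro eventually_ball_finite finS ballI)
    fix s assume "s \<in> S"
    show "\<forall>\<^sub>F \<epsilon> in at_right 0. c s - \<epsilon> * a s > 0"
    proof (cases "a s = 0")
      case False
      then have "\<forall>\<^sub>F \<epsilon> in at_right 0. c s + \<epsilon> * - a s > 0"
        using eventually_sign_pos[of "- a s" "c s"] c[OF \<open>s \<in> S\<close>]
        by (auto simp: sign_pos_def elim: eventually_mono)
      then show ?thesis by simp
    qed (use c[OF \<open>s \<in> S\<close>] in auto)
  qed
  moreover have "\<forall>\<^sub>F \<epsilon> in at_right (0::real). \<epsilon> > 0"
    by (simp add: eventually_at_right_less)
  ultimately have "\<forall>\<^sub>F \<epsilon> in at_right (0::real). \<epsilon> > 0 \<and> (\<forall>s\<in>S. c s - \<epsilon> * a s > 0)"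
    by eventually_elim blast
  then obtain \<epsilon> where \<epsilon>: "\<epsilon> > 0" "\<And>s. s \<in> S \<Longrightarrow> c s - \<epsilon> * a s > 0"
    using eventually_happens[of _ "at_right (0::real)"] by force
  define \<mu> where "\<mu> w = (if w \<in> S then c w - \<epsilon> * a w else 0) + \<epsilon>" for w
  have "x = (\<Sum>s\<in>S. (c s - \<epsilon> * a s) *\<^sub>R s) + \<epsilon> *\<^sub>R (\<Sum>w\<in>W. w)"
    unfolding a x(2) by (simp add: scaleR_diff_left sum_subtractf scaleR_sum_right)
  also have "\<dots> = (\<Sum>w\<in>W. \<mu> w *\<^sub>R w)"
    unfolding lincomb_subset[OF S(1), symmetric]
    by (simp add: \<mu>_def scaleR_left_distrib sum.distrib scaleR_sum_right)
  finally have "x = (\<Sum>w\<in>W. \<mu> w *\<^sub>R w)" .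
  moreover have "\<forall>w\<in>W. \<mu> w > 0" using \<epsilon> by (auto simp: \<mu>_def add_pos_pos)
  ultimately show ?thesis using d x(1) unfolding degree_bound_def by blast
qed

section \<open>Lattice points of the half-open parallelepiped of a basis\<close>

definition Box :: "'b set \<Rightarrow> 'b set"
  where "Box \<sigma> = {y \<in> L \<inter> span W. \<forall>i\<in>\<sigma>. 0 \<le> representation \<sigma> y i \<and> representation \<sigma> y i < 1}"

definition supp :: "'b set \<Rightarrow> 'b \<Rightarrow> 'b set"
  where "supp \<sigma> y = {i\<in>\<sigma>. representation \<sigma> y i \<noteq> 0}"

text \<open>Reduction modulo the lattice generated by \<sigma>; the box is a system of
  representatives of \<open>L \<inter> span W\<close> for it.\<close>

definition box_part :: "'b set \<Rightarrow> 'b \<Rightarrow> 'b"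
  where "box_part \<sigma> y = (\<Sum>i\<in>\<sigma>. frac (representation \<sigma> y i) *\<^sub>R i)"

lemma rep_box_part:
  "\<sigma> \<in> Bases \<Longrightarrow> i \<in> \<sigma> \<Longrightarrow> representation \<sigma> (box_part \<sigma> y) i = frac (representation \<sigma> y i)"
  unfolding box_part_def by (rule rep_basis_lincomb)

lemma box_part_in_Box:
  assumes "\<sigma> \<in> Bases" "y \<in> L" "y \<in> span W"
  shows "box_part \<sigma> y \<in> Box \<sigma>"
proof -
  have "box_part \<sigma> y = (\<Sum>i\<in>\<sigma>. representation \<sigma> y i *\<^sub>R i) - (\<Sum>i\<in>\<sigma>. of_int \<lfloor>representation \<sigma> y i\<rfloor> *\<^sub>R i)"
    by (simp add: box_part_def frac_def scaleR_diff_left sum_subtractf)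
  also have "\<dots> \<in> L"
    unfolding sum_rep[OF assms(1,3)] using assms(2) L_int_lincomb[OF Bases_subset[OF assms(1)]]
    by (rule L_diff)
  finally have "box_part \<sigma> y \<in> L" .
  moreover have "box_part \<sigma> y \<in> span W"
    unfolding box_part_def by (rule lincomb_in_span[OF Bases_subset[OF assms(1)]])
  ultimately show ?thesis by (simp add: Box_def rep_box_part assms(1) frac_lt_1)
qed

lemma finite_Box:
  assumes "\<sigma> \<in> Bases"
  shows "finite (Box \<sigma>)"
proof (rule finite_subset)
  show "Box \<sigma> \<subseteq> (\<Union>k\<le>dim W. {y \<in> L \<inter> Cone. ht y = real k})"
  proof
    fix y assume y: "y \<in> Box \<sigma>"
    then have yC: "y \<in> Cone" by (intro Cone_if_rep_nonneg[OF assms]) (auto simp: Box_def)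
    obtain m where m: "ht y = real m"
      using ht_nat[OF _ yC] y by (auto simp: Box_def)
    have "ht y = (\<Sum>i\<in>\<sigma>. representation \<sigma> y i)"
      using y by (intro ht_rep[OF assms]) (simp add: Box_def)
    also have "\<dots> \<le> (\<Sum>i\<in>\<sigma>. 1)"
      using y by (intro sum_mono) (auto simp: Box_def less_imp_le)
    finally have "ht y \<le> (\<Sum>i\<in>\<sigma>. 1)" .
    then show "y \<in> (\<Union>k\<le>dim W. {y \<in> L \<inter> Cone. ht y = real k})"
      using y yC m card_basis[OF assms] by (auto simp: Box_def)
  qed
qed (use finite_level in blast)

lemma sum_except_in_L:
  "\<sigma> \<in> Bases \<Longrightarrow> (\<Sum>i\<in>\<sigma>. (if i \<in> A then 0 else 1) *\<^sub>R i) \<in> L"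
  using L_int_lincomb[OF Bases_subset, of \<sigma> "\<lambda>i. if i \<in> A then 0 else 1"]
  by (simp add: if_distrib cong: if_cong)

lemma ht_sum_except:
  assumes "\<sigma> \<in> Bases" "A \<subseteq> \<sigma>"
  shows "ht (\<Sum>i\<in>\<sigma>. (if i \<in> A then 0 else 1) *\<^sub>R i) = real (dim W) - real (card A)"
proof -
  have fin: "finite \<sigma>" by (rule finite_basis[OF assms(1)])
  have "(\<Sum>i\<in>\<sigma>. if i \<in> A then 0 else 1 :: real) = real (card (\<sigma> - A))"
    using fin by (simp add: sum.If_cases Diff_eq Compl_eq)
  also have "\<dots> = real (card \<sigma>) - real (card A)"
    using assms(2) fin by (metis card_Diff_subset card_mono finite_subset of_nat_diff)
  finally show ?thesis by (simp add: ht_lincomb[OF Bases_subset[OF assms(1)]] card_basis[OF assms(1)])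
qed

text \<open>Adding the elements of \<sigma> off the support makes \<open>y\<close> interior at
  height \<open>ht y + dim W - card (supp \<sigma> y)\<close>, so the support has at most
  \<open>ht y + d\<close> elements. The sum of \<sigma> minus \<open>y\<close> is interior at height
  \<open>dim W - ht y\<close>, so \<open>ht y \<le> d\<close>.\<close>

lemma card_supp_Box:
  assumes d: "degree_bound d" and \<sigma>: "\<sigma> \<in> Bases" and y: "y \<in> Box \<sigma>"
  shows "card (supp \<sigma> y) \<le> 2 * d"
proof -
  define r where "r = representation \<sigma> y"
  have yL: "y \<in> L" "y \<in> span W" and r: "\<And>i. i \<in> \<sigma> \<Longrightarrow> 0 \<le> r i \<and> r i < 1"
    using y by (auto simp: Box_def r_def)
  have fin: "finite \<sigma>" and sub: "\<sigma> \<subseteq> W" "W \<subseteq> span \<sigma>"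
    using \<sigma> finite_basis by (auto simp: Bases_def)
  have yr: "y = (\<Sum>i\<in>\<sigma>. r i *\<^sub>R i)" using sum_rep[OF \<sigma> yL(2)] by (simp add: r_def)
  define x1 where "x1 = y + (\<Sum>i\<in>\<sigma>. (if i \<in> supp \<sigma> y then 0 else 1) *\<^sub>R i)"
  have "x1 = (\<Sum>i\<in>\<sigma>. (r i + (if i \<in> supp \<sigma> y then 0 else 1)) *\<^sub>R i)"
    by (simp add: x1_def yr[symmetric] scaleR_left_distrib sum.distrib)
  moreover have "r i + (if i \<in> supp \<sigma> y then 0 else 1) > 0" if "i \<in> \<sigma>" for i
    using r[OF that] that by (auto simp: supp_def r_def order_less_le)
  moreover have "x1 \<in> L" unfolding x1_def by (intro L_add yL sum_except_in_L \<sigma>)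
  ultimately have "real (dim W) - ht x1 \<le> real d"
    by (intro degree_bound_subset[OF d sub])
  moreover have "supp \<sigma> y \<subseteq> \<sigma>" by (auto simp: supp_def)
  ultimately have 1: "real (card (supp \<sigma> y)) \<le> ht y + real d"
    using ht_sum_except[OF \<sigma>, of "supp \<sigma> y"] by (simp add: x1_def linear_add[OF linear_ht])
  define x2 where "x2 = (\<Sum>i\<in>\<sigma>. (if i \<in> {} then 0 else 1) *\<^sub>R i) - y"
  have "x2 = (\<Sum>i\<in>\<sigma>. (1 - r i) *\<^sub>R i)"
    by (simp add: x2_def yr[symmetric] scaleR_diff_left sum_subtractf)
  moreover have "x2 \<in> L" unfolding x2_def by (intro L_diff yL sum_except_in_L \<sigma>)
  ultimately have "real (dim W) - ht x2 \<le> real d"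
    using r by (intro degree_bound_subset[OF d sub, of x2 "\<lambda>i. 1 - r i"]) auto
  then have "ht y \<le> real d"
    using ht_sum_except[OF \<sigma>, of "{}"] unfolding x2_def by (simp add: linear_diff[OF linear_ht])
  with 1 show ?thesis by linarith
qed

text \<open>The elements of \<sigma> at which some point of \<open>L \<inter> span W\<close> has a
  non-integral coordinate.\<close>

definition moved :: "'b set \<Rightarrow> 'b set"
  where "moved \<sigma> = (\<Union>y\<in>Box \<sigma>. supp \<sigma> y)"

text \<open>The box is a group under addition modulo the simplex lattice. If \<open>i \<in> moved \<sigma>\<close>, adding
  an element with non-zero \<open>i\<close>-th coordinate injects the elements with zero \<open>i\<close>-th coordinate
  into the others, so at least half of the box has \<open>i\<close> in its support.\<close>

lemma half_Box_moved:
  assumes \<sigma>: "\<sigma> \<in> Bases" and i: "i \<in> moved \<sigma>"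
  shows "card (Box \<sigma>) \<le> 2 * card {y \<in> Box \<sigma>. i \<in> supp \<sigma> y}"
proof -
  obtain g where g: "g \<in> Box \<sigma>" "i \<in> supp \<sigma> g" using i by (auto simp: moved_def)
  have i\<sigma>: "i \<in> \<sigma>" "representation \<sigma> g i \<noteq> 0" using g(2) by (auto simp: supp_def)
  define Z where "Z = {y \<in> Box \<sigma>. i \<notin> supp \<sigma> y}"
  define N where "N = {y \<in> Box \<sigma>. i \<in> supp \<sigma> y}"
  have fin: "finite Z" "finite N" using finite_Box[OF \<sigma>] by (auto simp: Z_def N_def)
  have rep: "representation \<sigma> (y + g) j = representation \<sigma> y j + representation \<sigma> g j"
    if "y \<in> Box \<sigma>" for y j
    using that g(1) by (intro rep_add[OF \<sigma>]) (auto simp: Box_def)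
  have "card Z \<le> card N"
  proof (rule card_inj_on_le[of "\<lambda>y. box_part \<sigma> (y + g)"])
    show "inj_on (\<lambda>y. box_part \<sigma> (y + g)) Z"
    proof (rule inj_onI)
      fix x y assume xy: "x \<in> Z" "y \<in> Z" "box_part \<sigma> (x + g) = box_part \<sigma> (y + g)"
      then have B: "x \<in> Box \<sigma>" "y \<in> Box \<sigma>" by (auto simp: Z_def)
      have "representation \<sigma> x j = representation \<sigma> y j" if j: "j \<in> \<sigma>" for j
      proof -
        have "frac (representation \<sigma> x j + representation \<sigma> g j) =
            frac (representation \<sigma> y j + representation \<sigma> g j)"
          using xy(3) rep_box_part[OF \<sigma> j, of "x + g"] rep_box_part[OF \<sigma> j, of "y + g"] rep B
          by simp
        then have "representation \<sigma> x j - representation \<sigma> y j =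
            of_int (\<lfloor>representation \<sigma> x j + representation \<sigma> g j\<rfloor> -
              \<lfloor>representation \<sigma> y j + representation \<sigma> g j\<rfloor>)"
          by (simp add: frac_def)
        then obtain k :: int where k: "representation \<sigma> x j - representation \<sigma> y j = of_int k"
          by blast
        have "\<bar>representation \<sigma> x j - representation \<sigma> y j\<bar> < 1"
        proof -
          have "0 \<le> representation \<sigma> x j" "representation \<sigma> x j < 1"
            "0 \<le> representation \<sigma> y j" "representation \<sigma> y j < 1"
            using B j by (auto simp: Box_def)
          then show ?thesis by linarith
        qed
        then have "k = 0" using k by simp
        then show ?thesis using k by simp
      qed
      moreover have "x \<in> span W" "y \<in> span W" using B by (auto simp: Box_def)
      ultimately show "x = y"
        using sum_rep[OF \<sigma>, of x] sum_rep[OF \<sigma>, of y] by (metis (no_types, lifting) sum.cong)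
    qed
    show "(\<lambda>y. box_part \<sigma> (y + g)) ` Z \<subseteq> N"
    proof safe
      fix y assume y: "y \<in> Z"
      then have B: "y \<in> Box \<sigma>" "representation \<sigma> y i = 0"
        using i\<sigma> by (auto simp: Z_def supp_def)
      have "box_part \<sigma> (y + g) \<in> Box \<sigma>"
        using B(1) g(1) by (intro box_part_in_Box[OF \<sigma>]) (auto simp: Box_def intro: L_add span_add)
      moreover have "representation \<sigma> (box_part \<sigma> (y + g)) i = representation \<sigma> g i"
        using rep_box_part[OF \<sigma> i\<sigma>(1)] rep[OF B(1)] B(2) g(1) i\<sigma>(1)
        by (simp add: Box_def frac_eq)
      ultimately show "box_part \<sigma> (y + g) \<in> N" using i\<sigma> by (simp add: N_def supp_def)
    qed
  qed (rule fin)
  moreover have "card (Box \<sigma>) = card Z + card N"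
  proof -
    have "Box \<sigma> = Z \<union> N" "Z \<inter> N = {}" by (auto simp: Z_def N_def)
    then show ?thesis using fin by (metis card_Un_disjoint)
  qed
  ultimately show ?thesis by (simp add: N_def)
qed

text \<open>For \<open>d = 0\<close> the truncated subtraction says that nothing is moved.\<close>

lemma card_moved:
  assumes d: "degree_bound d" and \<sigma>: "\<sigma> \<in> Bases"
  shows "card (moved \<sigma>) \<le> 4 * d - 1"
proof -
  have fin: "finite (Box \<sigma>)" "finite \<sigma>" using \<sigma> finite_Box finite_basis by auto
  have finm: "finite (moved \<sigma>)" by (rule finite_subset[OF _ fin(2)]) (auto simp: moved_def supp_def)
  have 0: "0 \<in> Box \<sigma>" "supp \<sigma> 0 = {}"
    by (simp_all add: Box_def supp_def L_zero span_zero real_vector.representation_zero)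
  \<comment> \<open>Double counting of the pairs \<open>(i, y)\<close> with \<open>i\<close> in the
    support of \<open>y\<close>: at least half the box for each \<open>i\<close>, at most
    \<open>2 * d\<close> elements for each \<open>y\<close>.\<close>
  have "card (moved \<sigma>) * card (Box \<sigma>) \<le> (\<Sum>i\<in>moved \<sigma>. 2 * card {y \<in> Box \<sigma>. i \<in> supp \<sigma> y})"
    using sum_mono[of "moved \<sigma>" "\<lambda>_. card (Box \<sigma>)"] half_Box_moved[OF \<sigma>] by simp
  also have "\<dots> = 2 * (\<Sum>i\<in>moved \<sigma>. \<Sum>y\<in>Box \<sigma>. if i \<in> supp \<sigma> y then 1 else 0)"
    using fin by (simp add: sum_distrib_left[symmetric] sum.If_cases Int_def)
  also have "\<dots> = 2 * (\<Sum>y\<in>Box \<sigma>. \<Sum>i\<in>moved \<sigma>. if i \<in> supp \<sigma> y then 1 else 0)"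
    by (subst sum.swap) (rule refl)
  also have "\<dots> = 2 * (\<Sum>y\<in>Box \<sigma>. card (supp \<sigma> y))"
  proof -
    have "moved \<sigma> \<inter> {i. i \<in> supp \<sigma> y} = supp \<sigma> y" if "y \<in> Box \<sigma>" for y
      using that by (auto simp: moved_def)
    then show ?thesis using finm by (simp add: sum.If_cases cong: sum.cong)
  qed
  \<comment> \<open>Leaving out the origin, whose support is empty, is what improves
    \<open>4 * d\<close> to \<open>4 * d - 1\<close>.\<close>
  also have "(\<Sum>y\<in>Box \<sigma>. card (supp \<sigma> y)) = (\<Sum>y\<in>Box \<sigma> - {0}. card (supp \<sigma> y))"
    using 0 fin(1) by (simp add: sum.remove[of _ 0])
  also have "\<dots> \<le> (\<Sum>y\<in>Box \<sigma> - {0}. 2 * d)"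
    using card_supp_Box[OF d \<sigma>] by (intro sum_mono) auto
  finally have *: "card (moved \<sigma>) * card (Box \<sigma>) \<le> 4 * d * (card (Box \<sigma>) - 1)"
    using 0 fin(1) by (simp add: card_Diff_singleton mult_ac)
  have pos: "card (Box \<sigma>) > 0" using 0 fin(1) card_gt_0_iff by blast
  show ?thesis
  proof (cases "d = 0")
    case True
    then show ?thesis using * pos by simp
  next
    case False
    then have "4 * d * (card (Box \<sigma>) - 1) < 4 * d * card (Box \<sigma>)" using pos by simp
    with * have "card (moved \<sigma>) * card (Box \<sigma>) < 4 * d * card (Box \<sigma>)" by (rule le_less_trans)
    then have "card (moved \<sigma>) < 4 * d" by simp
    then show ?thesis by linarith
  qed
qed

lemma rep_integer_if_not_moved:
  assumes "\<sigma> \<in> Bases" "i \<in> \<sigma>" "i \<notin> moved \<sigma>" "y \<in> L" "y \<in> span W"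
  shows "representation \<sigma> y i \<in> \<int>"
proof -
  have "representation \<sigma> (box_part \<sigma> y) i = 0"
    using assms box_part_in_Box[of \<sigma> y] by (auto simp: moved_def supp_def)
  then show ?thesis using rep_box_part[OF assms(1,2), of y] by (simp add: frac_eq_0_iff)
qed

text \<open>The affine dependence between \<open>w\<close> and \<open>\<sigma>\<close> allows to trade either side for the other, so
  dropping the generators of one side leaves a point interior to the cone.\<close>

lemma card_circuit:
  assumes d: "degree_bound d" and \<sigma>: "\<sigma> \<in> Bases" and w: "w \<in> W - \<sigma>"
  shows "card (supp \<sigma> w) \<le> 2 * d + 1"
proof -
  define a where "a = representation \<sigma> w"
  have fin: "finite \<sigma>" and sub: "\<sigma> \<subseteq> W" "W \<subseteq> span \<sigma>"
    using \<sigma> finite_basis by (auto simp: Bases_def)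
  have wa: "w = (\<Sum>i\<in>\<sigma>. a i *\<^sub>R i)" using sum_rep[OF \<sigma>, of w] w span_base[of w W] by (simp add: a_def)
  \<comment> \<open>The sum keeps every \<open>\<epsilon> * a i\<close> below 1 in absolute value,
    and the 2 keeps \<epsilon> itself below 1, so a shift by \<epsilon> times the dependence leaves
    no coefficient negative.\<close>
  define \<epsilon> where "\<epsilon> = 1 / (2 + (\<Sum>i\<in>\<sigma>. \<bar>a i\<bar>))"
  have s0: "(\<Sum>i\<in>\<sigma>. \<bar>a i\<bar>) \<ge> 0" by (simp add: sum_nonneg)
  have \<epsilon>: "0 < \<epsilon>" "\<epsilon> < 1" using s0 by (simp_all add: \<epsilon>_def divide_simps add_pos_nonneg)
  have \<epsilon>a: "\<bar>\<epsilon> * a i\<bar> < 1" if "i \<in> \<sigma>" for i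
  proof -
    have "\<bar>a i\<bar> \<le> (\<Sum>i\<in>\<sigma>. \<bar>a i\<bar>)" using that fin by (intro member_le_sum) auto
    then show ?thesis using s0 by (simp add: \<epsilon>_def abs_mult field_simps)
  qed
  have \<epsilon>w: "\<epsilon> *\<^sub>R w = (\<Sum>i\<in>\<sigma>. (\<epsilon> * a i) *\<^sub>R i)" by (subst wa) (simp add: scaleR_sum_right)
  define S where "S = insert w \<sigma>"
  have S: "S \<subseteq> W" "W \<subseteq> span S" using w sub span_mono[of \<sigma> S] by (auto simp: S_def)
  have sum_S: "(\<Sum>s\<in>S. c s *\<^sub>R s) = c w *\<^sub>R w + (\<Sum>i\<in>\<sigma>. c i *\<^sub>R i)" for c
    using w fin by (simp add: S_def)
  define P where "P = {i\<in>\<sigma>. a i > 0}"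
  define N where "N = {i\<in>\<sigma>. a i < 0}"
  have PN: "P \<subseteq> \<sigma>" "N \<subseteq> \<sigma>" by (auto simp: P_def N_def)
  \<comment> \<open>Expanding an \<epsilon>-part of \<open>w\<close> gives the dropped elements of
    \<open>P\<close> positive coefficients, while those of \<open>N\<close> stay near 1. The height
    is \<open>dim W + 1 - card P\<close>, the 1 coming from \<open>w\<close>.\<close>
  define x1 where "x1 = w + (\<Sum>i\<in>\<sigma>. (if i \<in> P then 0 else 1) *\<^sub>R i)"
  define c1 where "c1 s = (if s = w then 1 - \<epsilon> else (if s \<in> P then 0 else 1) + \<epsilon> * a s)" for s
  have "(\<Sum>i\<in>\<sigma>. c1 i *\<^sub>R i) = (\<Sum>i\<in>\<sigma>. ((if i \<in> P then 0 else 1) + \<epsilon> * a i) *\<^sub>R i)"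
    using w by (intro sum.cong) (auto simp: c1_def)
  also have "\<dots> = (\<Sum>i\<in>\<sigma>. (if i \<in> P then 0 else 1) *\<^sub>R i) + \<epsilon> *\<^sub>R w"
    by (simp add: \<epsilon>w scaleR_left_distrib sum.distrib)
  finally have "x1 = (\<Sum>s\<in>S. c1 s *\<^sub>R s)"
    unfolding sum_S by (simp add: x1_def c1_def scaleR_diff_left)
  moreover have "c1 s > 0" if "s \<in> S" for s
    using that \<epsilon> \<epsilon>a[of s] unfolding S_def c1_def P_def by (auto simp: abs_less_iff)
  moreover have "x1 \<in> L" unfolding x1_def using w W_subset_L by (intro L_add sum_except_in_L \<sigma>) auto
  ultimately have "real (dim W) - ht x1 \<le> real d" by (intro degree_bound_subset[OF d S])
  then have 1: "real (card P) \<le> real d + 1"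
    using w ht_sum_except[OF \<sigma> PN(1)] by (simp add: x1_def linear_add[OF linear_ht] ht_W)
  \<comment> \<open>The opposite trade: \<open>w\<close> enters with coefficient \<epsilon> and
    restores \<open>N\<close>. Here \<open>w\<close> adds nothing to the height, hence
    \<open>d\<close> and not \<open>d + 1\<close>.\<close>
  define x2 where "x2 = (\<Sum>i\<in>\<sigma>. (if i \<in> N then 0 else 1) *\<^sub>R i)"
  define c2 where "c2 s = (if s = w then \<epsilon> else (if s \<in> N then 0 else 1) - \<epsilon> * a s)" for s
  have "(\<Sum>i\<in>\<sigma>. c2 i *\<^sub>R i) = (\<Sum>i\<in>\<sigma>. ((if i \<in> N then 0 else 1) - \<epsilon> * a i) *\<^sub>R i)"
    using w by (intro sum.cong) (auto simp: c2_def)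
  also have "\<dots> = (\<Sum>i\<in>\<sigma>. (if i \<in> N then 0 else 1) *\<^sub>R i) - \<epsilon> *\<^sub>R w"
    by (simp add: \<epsilon>w scaleR_diff_left sum_subtractf)
  finally have "x2 = (\<Sum>s\<in>S. c2 s *\<^sub>R s)"
    unfolding sum_S by (simp add: x2_def c2_def)
  moreover have "c2 s > 0" if "s \<in> S" for s
    using that \<epsilon> \<epsilon>a[of s] unfolding S_def c2_def N_def by (auto simp: abs_less_iff mult_pos_neg)
  moreover have "x2 \<in> L" unfolding x2_def by (rule sum_except_in_L[OF \<sigma>])
  ultimately have "real (dim W) - ht x2 \<le> real d" by (intro degree_bound_subset[OF d S])
  then have 2: "real (card N) \<le> real d" using ht_sum_except[OF \<sigma> PN(2)] by (simp add: x2_def)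
  have "supp \<sigma> w = P \<union> N" by (auto simp: supp_def P_def N_def a_def)
  then have "card (supp \<sigma> w) \<le> card P + card N" by (simp add: card_Un_le)
  with 1 2 show ?thesis by linarith
qed

theorem exists_apex:
  assumes d: "degree_bound d" and pos: "dim W > 0" and d0: "d = 0 \<Longrightarrow> card W = dim W"
    and big: "dim W \<ge> (card W - dim W) * (2 * d + 1) + 4 * d"
  obtains v g where "v \<in> W" "linear g" "g v = (1::real)" "\<And>w. w \<in> W - {v} \<Longrightarrow> g w = 0"
    "\<And>y. y \<in> L \<Longrightarrow> y \<in> span W \<Longrightarrow> g y \<in> \<int>"
proof -
  obtain \<sigma> where \<sigma>: "\<sigma> \<in> Bases" using extend_to_basis[of "{}"] independent_empty by blast
  have fin: "finite \<sigma>" and sub: "\<sigma> \<subseteq> W" using \<sigma> finite_basis Bases_subset by auto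
  define bad where "bad = moved \<sigma> \<union> (\<Union>w\<in>W - \<sigma>. supp \<sigma> w)"
  have "card (\<Union>w\<in>W - \<sigma>. supp \<sigma> w) \<le> (\<Sum>w\<in>W - \<sigma>. card (supp \<sigma> w))"
    using finite_W by (intro card_UN_le) auto
  also have "\<dots> \<le> (\<Sum>w\<in>W - \<sigma>. 2 * d + 1)"
    by (intro sum_mono card_circuit[OF d \<sigma>])
  also have "\<dots> = (card W - dim W) * (2 * d + 1)"
    using sub fin card_basis[OF \<sigma>] by (simp add: card_Diff_subset)
  finally have "card bad \<le> (4 * d - 1) + (card W - dim W) * (2 * d + 1)"
    using card_moved[OF d \<sigma>] card_Un_le[of "moved \<sigma>" "\<Union>w\<in>W - \<sigma>. supp \<sigma> w"]
    unfolding bad_def by linarith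
  \<comment> \<open>For positive \<open>d\<close> the slack is the 1 in \<open>4 * d - 1\<close>.
    For \<open>d = 0\<close> both summands vanish, the second by \<open>d0\<close>, and
    \<open>dim W > 0\<close> decides.\<close>
  also have "\<dots> < dim W" using big d0 pos by (cases "d = 0") auto
  also have "\<dots> = card \<sigma>" using card_basis[OF \<sigma>] by simp
  finally have "card bad < card \<sigma>" .
  moreover have "bad \<subseteq> \<sigma>" by (auto simp: bad_def moved_def supp_def)
  ultimately obtain v where v: "v \<in> \<sigma>" "v \<notin> bad" by (metis order_less_irrefl subset_antisym subsetI)
  \<comment> \<open>\<open>representation\<close> is zero off the span and so in general not linear
    on the whole space; \<open>g\<close> is a linear extension of the
    \<open>v\<close>-coordinate.\<close>
  obtain g where g: "linear g" "\<And>i. i \<in> \<sigma> \<Longrightarrow> g i = (if i = v then 1 else 0 :: real)"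
    using linear_independent_extend[OF Bases_independent[OF \<sigma>], of "\<lambda>i. if i = v then 1 else 0 :: real"]
    by blast
  have g_rep: "g y = representation \<sigma> y v" if "y \<in> span W" for y
  proof -
    have "g y = (\<Sum>i\<in>\<sigma>. representation \<sigma> y i * g i)"
      by (subst sum_rep[OF \<sigma> that, symmetric]) (simp add: linear_sum[OF g(1)] linear_scale[OF g(1)])
    also have "\<dots> = (\<Sum>i\<in>\<sigma>. if i = v then representation \<sigma> y i else 0)"
      by (intro sum.cong) (auto simp: g(2))
    finally show ?thesis using fin v(1) by simp
  qed
  show ?thesis
  proof (rule that[of v g])
    show "g w = 0" if "w \<in> W - {v}" for w
    proof (cases "w \<in> \<sigma>")
      case False
      then have "v \<notin> supp \<sigma> w" using v that by (auto simp: bad_def)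
      then show ?thesis using v(1) that g_rep[of w] span_base by (auto simp: supp_def)
    qed (use that g in auto)
    show "g y \<in> \<int>" if "y \<in> L" "y \<in> span W" for y
      using rep_integer_if_not_moved[OF \<sigma> v(1) _ that] v(2) g_rep[OF that(2)] by (simp add: bad_def)
  qed (use v sub g in auto)
qed

end

section \<open>Lattice polytopes\<close>

text \<open>The vectors \<open>(x - a, 0)\<close> have rank \<open>aff_dim S\<close>, and
  \<open>(a, 1)\<close> lies outside the hyperplane containing them.\<close>

lemma aff_dim_eq_dim_homogenized:
  fixes S :: "'a::euclidean_space set"
  shows "int (dim ((\<lambda>x. (x, 1::real)) ` S)) = aff_dim S + 1"
proof (cases "S = {}")
  case False
  then obtain a where a: "a \<in> S" by blast
  define D where "D = (\<lambda>x. (x - a, 0::real)) ` S"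
  have "(\<lambda>x. (x, 1)) ` S \<subseteq> span (insert (a, 1) D)"
  proof safe
    fix x assume "x \<in> S"
    then have "(a, 1) + (x - a, 0) \<in> span (insert (a, 1) D)"
      by (intro span_add) (auto intro: span_base simp: D_def)
    then show "(x, 1) \<in> span (insert (a, 1) D)" by simp
  qed
  moreover have "insert (a, 1) D \<subseteq> span ((\<lambda>x. (x, 1)) ` S)"
  proof -
    have "(x, 1) - (a, 1) \<in> span ((\<lambda>x. (x, 1::real)) ` S)" if "x \<in> S" for x
      using that a by (intro span_diff span_base) auto
    then show ?thesis using a by (auto simp: D_def intro: span_base)
  qed
  ultimately have "span ((\<lambda>x. (x, 1)) ` S) = span (insert (a, 1) D)"
    by (metis span_minimal subset_antisym subspace_span)
  then have "dim ((\<lambda>x. (x, 1::real)) ` S) = dim (insert (a, 1) D)"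
    by (metis dim_span)
  also have "\<dots> = dim D + 1"
  proof -
    have "span D \<subseteq> {p. snd p = 0}"
      by (rule span_minimal) (auto simp: D_def subspace_def)
    then show ?thesis by (auto simp: dim_insert)
  qed
  also have "dim D = dim ((\<lambda>x. x - a) ` S)"
  proof -
    have "D = (\<lambda>x. (x, 0)) ` (\<lambda>x. x - a) ` S" by (auto simp: D_def)
    moreover have "linear (\<lambda>x::'a. (x, 0::real))" by (rule linearI) auto
    ultimately show ?thesis by (simp add: dim_image_eq inj_on_def)
  qed
  finally show ?thesis using aff_dim_eq_dim_subtract[OF hull_inc[OF a]] by simp
qed simp

text \<open>The dual basis of a lattice basis, extended to the ambient space. Off
  \<open>span M\<close> the extension is arbitrary, hence the relativised quantifiers.\<close>

lemma lattice_coordinates: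
  fixes M :: "'a::real_vector set"
  assumes "is_lattice M"
  shows "\<exists>m (f :: nat \<Rightarrow> 'a \<Rightarrow> real). (\<forall>j. linear (f j)) \<and>
    (\<forall>x\<in>span M. x \<in> M \<longleftrightarrow> (\<forall>j<m. f j x \<in> \<int>)) \<and> (\<forall>x\<in>span M. (\<forall>j<m. f j x = 0) \<longrightarrow> x = 0)"
proof -
  obtain B where B: "finite B" "independent B" "M = {\<Sum>b\<in>B. of_int (c b) *\<^sub>R b | c. True}"
    using assms unfolding is_lattice_def by blast
  obtain e where e: "bij_betw e {..<card B} B"
    using ex_bij_betw_nat_finite[OF B(1)] by (auto simp: atLeast0LessThan)
  define f where "f j = (SOME g. linear g \<and> (\<forall>b\<in>B. g b = (if b = e j then 1 else 0 :: real)))" for j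
  have f: "linear (f j) \<and> (\<forall>b\<in>B. f j b = (if b = e j then 1 else 0))" for j
    unfolding f_def by (rule someI_ex[OF linear_independent_extend[OF B(2)]])
  have flin: "linear (f j)" for j using f by blast
  have coord: "f j (\<Sum>b\<in>B. c b *\<^sub>R b) = c (e j)" if "j < card B" for c j
  proof -
    have "f j (\<Sum>b\<in>B. c b *\<^sub>R b) = (\<Sum>b\<in>B. if b = e j then c b else 0)"
      unfolding linear_sum[OF flin] linear_scale[OF flin] using f by (intro sum.cong) auto
    then show ?thesis using B(1) e that by (simp add: bij_betwE)
  qed
  have expand: "x = (\<Sum>b\<in>B. f (inv_into {..<card B} e b) x *\<^sub>R b)" if "x \<in> span B" for x
  proof -
    obtain c where c: "x = (\<Sum>b\<in>B. c b *\<^sub>R b)" using \<open>x \<in> span B\<close> span_finite[OF B(1)] by auto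
    have "f (inv_into {..<card B} e b) x = c b" if "b \<in> B" for b
    proof -
      have "inv_into {..<card B} e b < card B" "e (inv_into {..<card B} e b) = b"
        using e that bij_betw_imp_surj_on inv_into_into f_inv_into_f
        by (metis lessThan_iff)+
      then show ?thesis unfolding c by (simp add: coord)
    qed
    then show ?thesis using c by simp
  qed
  have "B \<subseteq> M"
  proof
    fix b assume "b \<in> B"
    then have "(\<Sum>b'\<in>B. of_int (if b' = b then 1 else 0) *\<^sub>R b') = b"
      using B(1) by (simp add: if_distrib if_distribR cong: if_cong)
    then show "b \<in> M"
      unfolding B(3) by (auto intro!: exI[of _ "\<lambda>b'. if b' = b then 1 else 0"] simp del: of_int_eq_iff)
  qed
  moreover have MB: "M \<subseteq> span B" unfolding B(3) by (auto intro: span_sum span_scale span_base)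
  ultimately have span: "span M = span B" by (metis span_minimal span_mono subset_antisym subspace_span)
  show ?thesis
  proof (intro exI[of _ "card B"] exI[of _ f] conjI)
    show "\<forall>x\<in>span M. x \<in> M \<longleftrightarrow> (\<forall>j<card B. f j x \<in> \<int>)"
    proof (intro ballI iffI)
      fix x assume "x \<in> M"
      then show "\<forall>j<card B. f j x \<in> \<int>" unfolding B(3) by (auto simp: coord)
    next
      fix x assume x: "x \<in> span M" "\<forall>j<card B. f j x \<in> \<int>"
      define c where "c b = \<lfloor>f (inv_into {..<card B} e b) x\<rfloor>" for b
      have "f (inv_into {..<card B} e b) x = of_int (c b)" if "b \<in> B" for b
      proof -
        have "inv_into {..<card B} e b < card B"
          using e that by (metis bij_betw_imp_surj_on inv_into_into lessThan_iff)
        then have "f (inv_into {..<card B} e b) x \<in> \<int>" using x(2) by blast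
        then show ?thesis unfolding c_def by (metis Ints_cases floor_of_int)
      qed
      then have "x = (\<Sum>b\<in>B. of_int (c b) *\<^sub>R b)" using expand[of x] x span by simp
      then show "x \<in> M" unfolding B(3) by blast
    qed
    show "\<forall>x\<in>span M. (\<forall>j<card B. f j x = 0) \<longrightarrow> x = 0"
    proof (intro ballI impI)
      fix x assume x: "x \<in> span M" "\<forall>j<card B. f j x = 0"
      have "f (inv_into {..<card B} e b) x = 0" if "b \<in> B" for b
        using e that x(2)
        by (metis bij_betw_imp_surj_on inv_into_into lessThan_iff)
      then show "x = 0" using expand[of x] x(1) span by simp
    qed
  qed (use flin in simp)
qed

lemma lattice_subgroup:
  assumes "is_lattice M"
  shows "0 \<in> M" "x \<in> M \<Longrightarrow> y \<in> M \<Longrightarrow> x - y \<in> M"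
proof -
  obtain m :: nat and f :: "nat \<Rightarrow> 'a \<Rightarrow> real"
    where f: "\<And>j. linear (f j)" "\<And>x. x \<in> span M \<Longrightarrow> x \<in> M \<longleftrightarrow> (\<forall>j<m. f j x \<in> \<int>)"
    using lattice_coordinates[OF assms] by metis
  show "0 \<in> M" using f(2)[of 0] by (simp add: span_zero linear_0[OF f(1)])
  show "x - y \<in> M" if "x \<in> M" "y \<in> M"
    using that f(2)[of x] f(2)[of y] f(2)[of "x - y"]
    by (simp add: linear_diff[OF f(1)] span_diff span_base)
qed

text \<open>Lattice points are determined by their integer coordinates, and linear functionals are
  bounded on \<open>S\<close>.\<close>

lemma finite_bounded_lattice_points:
  fixes M :: "'a::euclidean_space set"
  assumes "is_lattice M" "bounded S"
  shows "finite (S \<inter> M)"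
proof -
  obtain m :: nat and f :: "nat \<Rightarrow> 'a \<Rightarrow> real"
    where f: "\<And>j. linear (f j)" "\<And>x. x \<in> span M \<Longrightarrow> x \<in> M \<longleftrightarrow> (\<forall>j<m. f j x \<in> \<int>)"
    "\<And>x. x \<in> span M \<Longrightarrow> (\<And>j. j < m \<Longrightarrow> f j x = 0) \<Longrightarrow> x = 0"
    using lattice_coordinates[OF assms(1)] by blast
  have "\<exists>K::int. \<forall>x\<in>S. \<bar>f j x\<bar> \<le> of_int K" for j
  proof -
    have "bounded (f j ` S)"
      using assms(2) f(1) by (simp add: bounded_linear_image linear_conv_bounded_linear)
    then obtain C where "\<forall>x\<in>S. \<bar>f j x\<bar> \<le> C" by (auto simp: bounded_iff)
    then have "\<forall>x\<in>S. \<bar>f j x\<bar> \<le> of_int \<lceil>C\<rceil>" by (meson le_of_int_ceiling order_trans)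
    then show ?thesis by blast
  qed
  then obtain K :: "nat \<Rightarrow> int" where K: "\<And>j x. x \<in> S \<Longrightarrow> \<bar>f j x\<bar> \<le> of_int (K j)" by metis
  define F where "F x = (\<lambda>j\<in>{..<m}. \<lfloor>f j x\<rfloor>)" for x
  have int: "f j x = of_int \<lfloor>f j x\<rfloor>" if "x \<in> M" "j < m" for x j
    using that f(2)[of x] span_base[of x M] by (metis Ints_cases floor_of_int)
  have "inj_on F (S \<inter> M)"
  proof (rule inj_onI)
    fix x y assume xy: "x \<in> S \<inter> M" "y \<in> S \<inter> M" "F x = F y"
    have "f j (x - y) = 0" if "j < m" for j
    proof -
      have "\<lfloor>f j x\<rfloor> = \<lfloor>f j y\<rfloor>"
        using fun_cong[OF xy(3), of j] that by (simp add: F_def)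
      then show ?thesis using int[of x j] int[of y j] xy that by (simp add: linear_diff[OF f(1)])
    qed
    moreover have "x - y \<in> span M" using xy by (intro span_diff span_base) auto
    ultimately show "x = y" using f(3)[of "x - y"] by simp
  qed
  moreover have "F ` (S \<inter> M) \<subseteq> (\<Pi>\<^sub>E j\<in>{..<m}. {- K j..K j})"
  proof -
    have "- K j \<le> \<lfloor>f j x\<rfloor> \<and> \<lfloor>f j x\<rfloor> \<le> K j" if "x \<in> S" for x j
      using K[OF that, of j] by linarith
    then show ?thesis by (intro image_subsetI) (simp add: F_def restrict_PiE_iff)
  qed
  moreover have "finite (\<Pi>\<^sub>E j\<in>{..<m}. {- K j..K j})" by (intro finite_PiE) auto
  ultimately show ?thesis by (rule inj_on_finite)
qed

text \<open>Extremality concerns open segments, which injective affine maps preserve. Convexity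
  keeps the points of these segments inside \<open>S\<close>, where injectivity is
  available.\<close>

lemma vertices_affine_image:
  assumes aff: "\<And>x y u. \<phi> ((1 - u) *\<^sub>R x + u *\<^sub>R y) = (1 - u) *\<^sub>R \<phi> x + u *\<^sub>R \<phi> y"
    and inj: "inj_on \<phi> S" and S: "convex S"
  shows "vertices (\<phi> ` S) = \<phi> ` vertices S"
proof -
  have "\<phi> x extreme_point_of \<phi> ` S \<longleftrightarrow> x extreme_point_of S" if x: "x \<in> S" for x
  proof -
    have "\<phi> x \<in> open_segment (\<phi> a) (\<phi> b) \<longleftrightarrow> x \<in> open_segment a b" if ab: "a \<in> S" "b \<in> S" for a b
    proof -
      have "\<phi> a = \<phi> b \<longleftrightarrow> a = b" using inj ab by (auto dest: inj_onD)
      moreover have "\<phi> x = (1 - u) *\<^sub>R \<phi> a + u *\<^sub>R \<phi> b \<longleftrightarrow> x = (1 - u) *\<^sub>R a + u *\<^sub>R b"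
        if u: "0 < u" "u < 1" for u
      proof -
        have "(1 - u) *\<^sub>R a + u *\<^sub>R b \<in> S" using S ab u by (simp add: convex_alt)
        then show ?thesis unfolding aff[symmetric] using inj x by (auto dest: inj_onD)
      qed
      ultimately show ?thesis unfolding in_segment(2) by blast
    qed
    then show ?thesis using x by (auto simp: extreme_point_of_def)
  qed
  then show ?thesis by (auto simp: vertices_def extreme_point_of_def)
qed

section \<open>Recognising a lattice pyramid by its apex\<close>

lemma lookup_scaleR:
  "Poly_Mapping.lookup (r *\<^sub>R x) i = r *\<^sub>R Poly_Mapping.lookup (x :: 'i \<Rightarrow>\<^sub>0 'v::real_vector) i"
proof -
  have "finite {i. r *\<^sub>R Poly_Mapping.lookup x i \<noteq> 0}"
    by (rule finite_subset[OF _ finite_lookup[of x]]) auto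
  then show ?thesis by (simp add: scaleR_poly_mapping_def Abs_poly_mapping_inverse)
qed

text \<open>The coordinates of the ambient lattice embed \<open>Q\<close> into some \<open>\<real>\<^sup>m\<close>, so no basis of
  the lattice \<open>affine hull Q \<inter> M\<close> is needed.\<close>

lemma lattice_pyramid_if_apex:
  fixes M P :: "'a::euclidean_space set" and g :: "'a \<times> real \<Rightarrow> real"
  assumes M: "is_lattice M" and P: "P = convex hull V" and V: "finite V" "V \<subseteq> M" "v \<in> V"
    and g: "linear g" "g (v, 1) = 1" "\<And>w. w \<in> V - {v} \<Longrightarrow> g (w, 1) = 0"
    and gint: "\<And>y. y \<in> affine hull P \<Longrightarrow> y \<in> M \<Longrightarrow> g (y, 1) \<in> \<int>"
  defines "Q \<equiv> convex hull (V - {v})"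
  shows "lattice_polytope M Q" "aff_dim Q = aff_dim P - 1" "lattice_pyramid_over M P Q"
proof -
  obtain m :: nat and f :: "nat \<Rightarrow> 'a \<Rightarrow> real"
    where f: "\<And>j. linear (f j)" "\<And>x. x \<in> span M \<Longrightarrow> x \<in> M \<longleftrightarrow> (\<forall>j<m. f j x \<in> \<int>)"
    "\<And>x. x \<in> span M \<Longrightarrow> (\<And>j. j < m \<Longrightarrow> f j x = 0) \<Longrightarrow> x = 0"
    using lattice_coordinates[OF M] by blast
  define \<psi> where "\<psi> x = (\<Sum>j<m. Poly_Mapping.single j (f j x))" for x
  have lookup_\<psi>: "Poly_Mapping.lookup (\<psi> x) i = (if i < m then f i x else 0)" for x i
  proof -
    have "Poly_Mapping.lookup (\<psi> x) i = (\<Sum>j<m. if i = j then f j x else 0)"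
      by (simp add: \<psi>_def lookup_sum lookup_single when_def eq_commute)
    then show ?thesis by simp
  qed
  have lin\<psi>: "linear \<psi>"
    by (rule linearI; rule poly_mapping_eqI)
      (simp_all add: lookup_\<psi> lookup_add lookup_scaleR linear_add[OF f(1)] linear_scale[OF f(1)])
  define e where "e = Poly_Mapping.single m (1::real)"
  \<comment> \<open>A shear along \<open>g\<close>: where \<open>g\<close> is 0, as on
    \<open>Q\<close>, it is \<open>\<psi>\<close> lifted to 1 in the new coordinate
    \<open>m\<close>, and \<open>v\<close>, where \<open>g\<close> is 1, goes to the origin. The new
    coordinate is \<open>1 - g (x, 1)\<close>.\<close>
  define \<phi> where "\<phi> x = \<psi> x - g (x, 1) *\<^sub>R (\<psi> v + e) + e" for x
  have g_affine: "g ((1 - u) *\<^sub>R x + u *\<^sub>R y, 1) = (1 - u) * g (x, 1) + u * g (y, 1)" for x y u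
  proof -
    have "((1 - u) *\<^sub>R x + u *\<^sub>R y, 1) = (1 - u) *\<^sub>R (x, 1::real) + u *\<^sub>R (y, 1)" by simp
    then show ?thesis by (simp only: linear_add[OF g(1)] linear_scale[OF g(1)]) simp
  qed
  have g_aff3: "g (x + y - z, 1) = g (x, 1) + g (y, 1) - g (z, 1)" for x y z
  proof -
    have "(x + y - z, 1) = (x, 1::real) + (y, 1) - (z, 1)" by simp
    then show ?thesis by (simp only: linear_add[OF g(1)] linear_diff[OF g(1)])
  qed
  have \<phi>3: "\<phi> (x + y - z) = \<phi> x + \<phi> y - \<phi> z" for x y z
    by (simp add: \<phi>_def g_aff3 linear_add[OF lin\<psi>] linear_diff[OF lin\<psi>] algebra_simps)
  have \<phi>_affine: "\<phi> ((1 - u) *\<^sub>R x + u *\<^sub>R y) = (1 - u) *\<^sub>R \<phi> x + u *\<^sub>R \<phi> y" for x y u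
    by (simp only: \<phi>_def g_affine linear_add[OF lin\<psi>] linear_scale[OF lin\<psi>])
      (simp add: algebra_simps)
  \<comment> \<open>The linear part of \<phi>, so that hulls can be carried through a linear map and
    a translation separately.\<close>
  define T where "T x = \<phi> x - \<phi> 0" for x
  have linT: "linear T"
  proof (rule linearI)
    show "T (x + y) = T x + T y" for x y
      using \<phi>3[of x y 0] by (simp add: T_def)
    show "T (r *\<^sub>R x) = r *\<^sub>R T x" for r x
      using \<phi>_affine[of r 0 x] by (simp add: T_def algebra_simps)
  qed
  have \<phi>T: "\<phi> ` S = (+) (\<phi> 0) ` T ` S" for S by (auto simp: T_def image_image)
  have conv\<phi>: "convex hull (\<phi> ` S) = \<phi> ` (convex hull S)" for S
    unfolding \<phi>T convex_hull_translation convex_hull_linear_image[OF linT, symmetric] ..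
  have aff\<phi>: "affine hull (\<phi> ` S) = \<phi> ` (affine hull S)" for S
    unfolding \<phi>T affine_hull_translation
    using affine_hull_linear_image[of T S] linT by (simp add: linear_conv_bounded_linear)
  have VP: "V \<subseteq> P" "Q \<subseteq> P" unfolding P Q_def by (auto simp: hull_subset hull_mono)
  have PQ: "P = convex hull ({v} \<union> Q)"
    unfolding Q_def hull_Un_right[symmetric] P using V(3) by (simp add: insert_absorb)
  have affP: "affine hull P \<subseteq> span M"
    unfolding P affine_hull_convex_hull using affine_hull_subset_span span_mono[OF V(2)] by blast
  have gQ: "g (x, 1) = 0" if "x \<in> affine hull (V - {v})" for x
  proof -
    have "affine {x. g (x, 1) = 0}"
      unfolding affine_alt by (simp add: g_affine)
    then have "affine hull (V - {v}) \<subseteq> {x. g (x, 1) = 0}"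
      using g(3) by (intro hull_minimal) auto
    then show ?thesis using that by auto
  qed
  have Qsub: "Q \<subseteq> affine hull (V - {v})" unfolding Q_def by (rule convex_hull_subset_affine_hull)
  show "aff_dim Q = aff_dim P - 1"
  proof -
    have "v \<notin> affine hull (V - {v})" using gQ g(2) by fastforce
    then have "aff_dim (insert v (V - {v})) = aff_dim (V - {v}) + 1"
      unfolding aff_dim_insert by simp
    then show ?thesis unfolding P Q_def using V(3) by (simp add: aff_dim_convex_hull insert_absorb)
  qed
  then have l: "nat (aff_dim P - aff_dim Q) = Suc 0" by simp
  have latP: "lattice_polytope M P" and latQ: "lattice_polytope M Q"
    using V extreme_point_of_convex_hull
    by (auto simp: lattice_polytope_def vertices_def P Q_def polytope_convex_hull)
  show "lattice_polytope M Q" by (rule latQ)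
  have lookup_\<phi>: "Poly_Mapping.lookup (\<phi> x) i =
      (if i < m then f i x - g (x, 1) * f i v else if i = m then 1 - g (x, 1) else 0)" for x i
    by (simp add: \<phi>_def e_def lookup_add lookup_minus lookup_scaleR lookup_\<psi> lookup_single)
  have \<phi>_inj: "inj_on \<phi> (affine hull P)"
  proof (rule inj_onI)
    fix x y assume xy: "x \<in> affine hull P" "y \<in> affine hull P" "\<phi> x = \<phi> y"
    have "g (x, 1) = g (y, 1)" using lookup_\<phi>[of x m] lookup_\<phi>[of y m] xy(3) by simp
    then have "f j (x - y) = 0" if "j < m" for j
      using lookup_\<phi>[of x j] lookup_\<phi>[of y j] xy(3) that by (simp add: linear_diff[OF f(1)])
    moreover have "x - y \<in> span M" using xy affP by (intro span_diff) auto
    ultimately show "x = y" using f(3)[of "x - y"] by simp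
  qed
  have \<phi>_int: "\<phi> x \<in> int_lattice (m + 1) \<longleftrightarrow> x \<in> M" if x: "x \<in> affine hull P" for x
  proof -
    have keys: "Poly_Mapping.keys (\<phi> x) \<subseteq> {..<m + 1}"
      by (auto simp: in_keys_iff lookup_\<phi> split: if_splits)
    have fv: "f j v \<in> \<int>" if "j < m" for j
      using V(2,3) f(2)[of v] span_base[of v M] that by blast
    have xM: "x \<in> M \<longleftrightarrow> (\<forall>j<m. f j x \<in> \<int>)" using x affP f(2) by blast
    have "\<phi> x \<in> int_lattice (m + 1) \<longleftrightarrow> g (x, 1) \<in> \<int> \<and> (\<forall>j<m. f j x - g (x, 1) * f j v \<in> \<int>)"
    proof -
      have "1 - g (x, 1) \<in> \<int> \<longleftrightarrow> g (x, 1) \<in> \<int>"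
        using Ints_diff[of 1 "1 - g (x, 1)"] Ints_diff[of 1 "g (x, 1)"] by auto
      then show ?thesis using keys by (auto simp: int_lattice_def lookup_\<phi> split: if_splits)
    qed
    \<comment> \<open>Once \<open>g (x, 1)\<close> is an integer, the correction by a multiple of
      \<open>f j v\<close> is integral and can be undone.\<close>
    also have "\<dots> \<longleftrightarrow> g (x, 1) \<in> \<int> \<and> (\<forall>j<m. f j x \<in> \<int>)"
      using fv by (metis Ints_add Ints_diff Ints_mult diff_add_cancel)
    also have "\<dots> \<longleftrightarrow> x \<in> M" using gint[OF x] xM by blast
    finally show ?thesis .
  qed
  define B where "B = \<psi> ` Q"
  have lift: "lift_one m ` B = \<phi> ` Q"
    using gQ Qsub unfolding B_def image_image
    by (intro image_cong) (auto simp: lift_one_def \<phi>_def e_def)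
  have "\<phi> v = 0" by (simp add: \<phi>_def g(2))
  then have pyr: "std_pyramid (Suc 0) m B = \<phi> ` P"
    by (simp add: lift PQ conv\<phi>[symmetric])
  have base: "std_base (Suc 0) m B = \<phi> ` Q" by (simp add: lift)
  have latB: "lattice_polytope (int_lattice m) B"
    unfolding lattice_polytope_def
  proof
    show "polytope B"
      unfolding B_def Q_def using V by (intro polytope_linear_image lin\<psi> polytope_convex_hull) auto
    have "vertices B \<subseteq> \<psi> ` (V - {v})"
      unfolding vertices_def B_def Q_def convex_hull_linear_image[OF lin\<psi>]
      using extreme_point_of_convex_hull by blast
    also have "\<dots> \<subseteq> int_lattice m"
    proof (rule image_subsetI)
      fix x assume "x \<in> V - {v}"
      then have "f j x \<in> \<int>" if "j < m" for j
        using V(2) f(2)[of x] span_base[of x M] that by blast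
      then show "\<psi> x \<in> int_lattice m"
        by (auto simp: int_lattice_def in_keys_iff lookup_\<psi> split: if_splits)
    qed
    finally show "vertices B \<subseteq> int_lattice m" .
  qed
  have sub: "P \<subseteq> affine hull P" by (rule hull_subset)
  have vP: "vertices (\<phi> ` P) = \<phi> ` vertices P"
    by (intro vertices_affine_image \<phi>_affine inj_on_subset[OF \<phi>_inj sub]) (simp add: P)
  have vQ: "vertices (\<phi> ` Q) = \<phi> ` vertices Q"
    using sub VP by (intro vertices_affine_image \<phi>_affine inj_on_subset[OF \<phi>_inj]) (auto simp: Q_def)
  have "bij_betw \<phi> (affine hull P \<inter> M) (affine hull (\<phi> ` P) \<inter> int_lattice (m + 1))"
    unfolding bij_betw_def aff\<phi> using \<phi>_inj \<phi>_int by (auto simp: inj_on_def)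
  then have "polytope_iso M P (int_lattice (m + Suc 0)) (std_pyramid (Suc 0) m B) \<phi>"
    unfolding polytope_iso_def pyr using \<phi>3 vP by simp
  then show "lattice_pyramid_over M P Q"
    unfolding lattice_pyramid_over_def Let_def l
    using latP latQ VP(2) latB vQ base by metis
qed

section \<open>The cone over a polytope placed at height 1\<close>

lemma Cone_homogenized:
  fixes V :: "'a::real_vector set"
  assumes "graded_generators W ht" "finite V" and W: "W = (\<lambda>x. (x, 1::real)) ` V"
  shows "graded_generators.Cone W = {(\<Sum>v\<in>V. c v *\<^sub>R v, \<Sum>v\<in>V. c v) | c. \<forall>v\<in>V. c v \<ge> 0}"
proof -
  interpret graded_generators W ht by (rule assms(1))
  have inj: "inj_on (\<lambda>x. (x, 1::real)) V" by (simp add: inj_on_def)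
  have sum: "(\<Sum>w\<in>W. \<mu> w *\<^sub>R w) = (\<Sum>v\<in>V. \<mu> (v, 1) *\<^sub>R v, \<Sum>v\<in>V. \<mu> (v, 1))" for \<mu>
    by (simp add: W sum.reindex[OF inj] prod_eq_iff fst_sum snd_sum)
  show ?thesis
  proof (intro equalityI subsetI)
    fix y assume "y \<in> Cone"
    then obtain \<mu> where "y = (\<Sum>w\<in>W. \<mu> w *\<^sub>R w)" "\<forall>w\<in>W. \<mu> w \<ge> 0" by (auto simp: Cone_def)
    then show "y \<in> {(\<Sum>v\<in>V. c v *\<^sub>R v, \<Sum>v\<in>V. c v) | c. \<forall>v\<in>V. c v \<ge> 0}"
      unfolding sum by (auto simp: W intro!: exI[of _ "\<lambda>v. \<mu> (v, 1)"])
  next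
    fix y assume "y \<in> {(\<Sum>v\<in>V. c v *\<^sub>R v, \<Sum>v\<in>V. c v) | c. \<forall>v\<in>V. c v \<ge> 0}"
    then obtain c where c: "y = (\<Sum>v\<in>V. c v *\<^sub>R v, \<Sum>v\<in>V. c v)" "\<forall>v\<in>V. c v \<ge> 0" by blast
    have "(\<Sum>w\<in>W. c (fst w) *\<^sub>R w) \<in> Cone" using c(2) by (intro ConeI) (auto simp: W)
    then show "y \<in> Cone" using sum[of "\<lambda>w. c (fst w)"] c(1) by simp
  qed
qed

lemma Cone_level:
  fixes V :: "'a::real_vector set"
  assumes gg: "graded_generators W ht" and V: "finite V" "V \<noteq> {}" and W: "W = (\<lambda>x. (x, 1::real)) ` V"
  shows "graded_generators.Cone W \<inter> {y. snd y = real k} =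
    (\<lambda>x. (real k *\<^sub>R x, real k)) ` (convex hull V)"
  unfolding Cone_homogenized[OF gg V(1) W] convex_hull_finite[OF V(1)]
proof (intro equalityI subsetI)
  fix y assume "y \<in> {(\<Sum>v\<in>V. c v *\<^sub>R v, \<Sum>v\<in>V. c v) | c. \<forall>v\<in>V. c v \<ge> 0} \<inter> {y. snd y = real k}"
  then obtain c where c: "\<forall>v\<in>V. c v \<ge> 0" "y = (\<Sum>v\<in>V. c v *\<^sub>R v, real k)" "(\<Sum>v\<in>V. c v) = real k"
    by auto
  show "y \<in> (\<lambda>x. (real k *\<^sub>R x, real k)) `
      {y. \<exists>u. (\<forall>x\<in>V. 0 \<le> u x) \<and> sum u V = 1 \<and> (\<Sum>x\<in>V. u x *\<^sub>R x) = y}"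
  proof (cases "k = 0")
    \<comment> \<open>Level 0 consists of the origin alone, which is the image of any point of the
      hull; this is where \<open>V \<noteq> {}\<close> enters.\<close>
    case True
    then have "\<forall>v\<in>V. c v = 0" using c V(1) by (simp add: sum_nonneg_eq_0_iff)
    moreover obtain v where "v \<in> V" using V(2) by blast
    then have "\<exists>u. (\<forall>x\<in>V. 0 \<le> u x) \<and> sum u V = (1::real)"
      using V(1) by (intro exI[of _ "\<lambda>x. if x = v then 1 else 0"]) auto
    ultimately show ?thesis using True c(2) by auto
  next
    case False
    show ?thesis
    proof (rule image_eqI[of _ _ "\<Sum>v\<in>V. (c v / real k) *\<^sub>R v"])
      show "y = (real k *\<^sub>R (\<Sum>v\<in>V. (c v / real k) *\<^sub>R v), real k)"
        using False by (simp add: c(2) scaleR_sum_right)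
      show "(\<Sum>v\<in>V. (c v / real k) *\<^sub>R v) \<in>
          {y. \<exists>u. (\<forall>x\<in>V. 0 \<le> u x) \<and> sum u V = 1 \<and> (\<Sum>x\<in>V. u x *\<^sub>R x) = y}"
        using False c by (auto intro!: exI[of _ "\<lambda>v. c v / real k"] simp: sum_divide_distrib[symmetric])
    qed
  qed
next
  fix y assume "y \<in> (\<lambda>x. (real k *\<^sub>R x, real k)) `
      {y. \<exists>u. (\<forall>x\<in>V. 0 \<le> u x) \<and> sum u V = 1 \<and> (\<Sum>x\<in>V. u x *\<^sub>R x) = y}"
  then obtain u where u: "\<forall>x\<in>V. 0 \<le> u x" "sum u V = 1"
    "y = (real k *\<^sub>R (\<Sum>x\<in>V. u x *\<^sub>R x), real k)" by blast
  then show "y \<in> {(\<Sum>v\<in>V. c v *\<^sub>R v, \<Sum>v\<in>V. c v) | c. \<forall>v\<in>V. c v \<ge> 0} \<inter> {y. snd y = real k}"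
    by (auto intro!: exI[of _ "\<lambda>v. real k * u v"] simp: scaleR_sum_right sum_distrib_left[symmetric])
qed

lemma fps_one_minus_X_power_nth_1: "fps_nth ((1 - fps_X :: int fps) ^ N) 1 = - int N"
  by (induction N) (simp_all add: fps_nth_power_0)

theorem mainTheorem2:
  fixes M P :: "'a::euclidean_space set" and n :: nat
  assumes "is_lattice M"
    and "lattice_polytope M P"
    and "aff_dim P = int n"
    and "int n \<ge> coeff (h_star M P) 1 * (2 * int (degree (h_star M P)) + 1)
           + 4 * int (degree (h_star M P)) - 1"
  shows "\<exists>Q. lattice_polytope M Q \<and> aff_dim Q = int n - 1 \<and> lattice_pyramid_over M P Q"
proof -
  have poly: "polytope P" and vert: "vertices P \<subseteq> M"
    using assms(2) by (auto simp: lattice_polytope_def)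
  \<comment> \<open>All lattice points and not just the vertices, so that \<open>card W\<close> is
    the number that determines h*_1.\<close>
  define V where "V = P \<inter> M"
  have bdd: "bounded ((\<lambda>x. real k *\<^sub>R x) ` P)" for k
    using polytope_imp_bounded[OF poly] by (rule bounded_scaling)
  have finV: "finite V"
    unfolding V_def using finite_bounded_lattice_points[OF assms(1) polytope_imp_bounded[OF poly]] .
  have P_hull: "P = convex hull V"
  proof
    have "vertices P \<subseteq> V" using vert by (auto simp: V_def vertices_def extreme_point_of_def)
    moreover have "P = convex hull (vertices P)"
      using poly Krein_Milman_Minkowski[of P]
      by (simp add: vertices_def polytope_imp_compact polytope_imp_convex)
    ultimately show "P \<subseteq> convex hull V" by (metis hull_mono)
    show "convex hull V \<subseteq> P" by (rule hull_minimal) (auto simp: V_def polytope_imp_convex[OF poly])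
  qed
  have "P \<noteq> {}" using assms(3) by auto
  then have V0: "V \<noteq> {}" using P_hull by auto
  define W where "W = (\<lambda>x. (x, 1::real)) ` V"
  define L where "L = M \<times> (\<int> :: real set)"
  have gg: "graded_generators W snd"
    by unfold_locales (auto simp: W_def finV linear_snd)
  have level: "{y \<in> L \<inter> graded_generators.Cone W. snd y = real k} =
      (\<lambda>x. (x, real k)) ` ((\<lambda>x. real k *\<^sub>R x) ` P \<inter> M)" for k
  proof -
    have "{y \<in> L \<inter> graded_generators.Cone W. snd y = real k} =
        L \<inter> (graded_generators.Cone W \<inter> {y. snd y = real k})" by auto
    also have "\<dots> = (\<lambda>x. (x, real k)) ` ((\<lambda>x. real k *\<^sub>R x) ` P \<inter> M)"
      unfolding Cone_level[OF gg finV V0 W_def] P_hull[symmetric] by (auto simp: L_def)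
    finally show ?thesis .
  qed
  interpret graded_generators W snd by (rule gg)
  interpret graded_lattice W snd L
  proof
    show "0 \<in> L" using lattice_subgroup(1)[OF assms(1)] by (simp add: L_def zero_prod_def)
    show "x - y \<in> L" if "x \<in> L" "y \<in> L" for x y
      using that lattice_subgroup(2)[OF assms(1)] by (auto simp: L_def)
    show "W \<subseteq> L" by (auto simp: W_def L_def V_def)
    show "snd y \<in> \<int>" if "y \<in> L" for y using that by (auto simp: L_def)
    show "finite {y \<in> L \<inter> Cone. snd y = real k}" for k
      unfolding level using finite_bounded_lattice_points[OF assms(1) bdd] by simp
  qed
  have count: "count k = ehrhart M P k" for k
  proof -
    have "count k = card ((\<lambda>x. real k *\<^sub>R x) ` P \<inter> M)"
      unfolding count_def level by (intro card_image) (simp add: inj_on_def)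
    \<comment> \<open>Level 0 of the cone holds exactly one lattice point, in accordance with the
      value of \<open>ehrhart\<close> at 0.\<close>
    moreover have "(\<lambda>x. 0) ` P \<inter> M = {0}"
      using \<open>P \<noteq> {}\<close> lattice_subgroup(1)[OF assms(1)] by auto
    ultimately show ?thesis by (simp add: ehrhart_def)
  qed
  have dimW: "int (dim W) = int n + 1"
    unfolding W_def aff_dim_eq_dim_homogenized using assms(3) P_hull by (metis aff_dim_convex_hull)
  have cardW: "card W = ehrhart M P 1"
    unfolding W_def by (subst card_image) (simp_all add: inj_on_def ehrhart_def V_def)
  obtain h where h: "fps_of_poly h = Abs_fps (\<lambda>k. int (count k)) * (1 - fps_X) ^ dim W"
    and bound: "degree_bound (degree h)"
    by (rule numerator_exists) (rule that)
  have "h_star M P = h"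
    unfolding h_star_def
  proof (rule the_equality)
    have "nat (aff_dim P + 1) = dim W" using dimW assms(3) by simp
    then show *: "fps_of_poly h =
        Abs_fps (\<lambda>k. int (ehrhart M P k)) * (1 - fps_X) ^ nat (aff_dim P + 1)"
      using h by (simp add: count)
    show "h' = h" if "fps_of_poly h' =
        Abs_fps (\<lambda>k. int (ehrhart M P k)) * (1 - fps_X) ^ nat (aff_dim P + 1)" for h'
      using that * by (metis fps_of_poly_eq_iff)
  qed
  define d where "d = degree h"
  have d: "degree_bound d" using bound by (simp add: d_def)
  \<comment> \<open>The linear term of \<open>1 + card W * t + ...\<close> times
    \<open>(1 - t) ^ dim W\<close>.\<close>
  have h1: "coeff h 1 = int (card W) - int (dim W)"
  proof -
    have "coeff h 1 = fps_nth (fps_of_poly h) 1" by simp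
    also have "\<dots> = int (count 0) * - int (dim W) + int (count 1)"
      unfolding h fps_mult_nth_1 fps_one_minus_X_power_nth_1 by (simp add: fps_nth_power_0)
    finally show ?thesis by (simp add: count cardW) (simp add: ehrhart_def)
  qed
  have dim_le: "dim W \<le> card W" using finite_W by (rule dim_le_card')
  have hyp: "int n \<ge> (int (card W) - int (dim W)) * (2 * int d + 1) + 4 * int d - 1"
    using assms(4) h1 \<open>h_star M P = h\<close> by (simp add: d_def)
  have "int ((card W - dim W) * (2 * d + 1) + 4 * d) =
      (int (card W) - int (dim W)) * (2 * int d + 1) + 4 * int d"
    using dim_le by (simp only: of_nat_add of_nat_mult of_nat_diff of_nat_numeral of_nat_1)
  \<comment> \<open>The -1 of the hypothesis is absorbed by \<open>dim W = n + 1\<close>. The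
    subtraction of naturals is exact by \<open>dim_le\<close>.\<close>
  then have "int ((card W - dim W) * (2 * d + 1) + 4 * d) \<le> int (dim W)"
    using hyp dimW by linarith
  then have big: "dim W \<ge> (card W - dim W) * (2 * d + 1) + 4 * d" by (rule of_nat_le_iff[THEN iffD1])
  \<comment> \<open>A numerator of degree 0 has no linear term.\<close>
  have d0: "card W = dim W" if "d = 0"
    using h1 coeff_eq_0[of h 1] that by (simp add: d_def)
  have "dim W > 0" using dimW by linarith
  from exists_apex[OF d this d0 big]
  obtain p g where p: "p \<in> W" "linear g" "g p = (1::real)" "\<And>w. w \<in> W - {p} \<Longrightarrow> g w = 0"
    "\<And>y. y \<in> L \<Longrightarrow> y \<in> span W \<Longrightarrow> g y \<in> \<int>" by blast
  obtain v where v: "p = (v, 1)" "v \<in> V" using p(1) by (auto simp: W_def)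
  \<comment> \<open>The affine hull placed at height 1 stays in \<open>span W\<close>, so
    integrality on \<open>L\<close> covers every lattice point on which the isomorphism is
    defined.\<close>
  have "g (y, 1) \<in> \<int>" if y: "y \<in> affine hull P" "y \<in> M" for y
  proof -
    have "affine {x. (x, 1) \<in> span W}"
      unfolding affine_alt
    proof safe
      fix x y u assume "(x, 1) \<in> span W" "(y, 1) \<in> span W"
      then have "(1 - u) *\<^sub>R (x, 1) + u *\<^sub>R (y, 1) \<in> span W" by (intro span_add span_scale)
      then show "((1 - u) *\<^sub>R x + u *\<^sub>R y, 1) \<in> span W" by simp
    qed
    then have "affine hull V \<subseteq> {x. (x, 1) \<in> span W}"
      by (intro hull_minimal) (auto simp: W_def intro: span_base)
    then have "(y, 1) \<in> span W" using y(1) unfolding P_hull affine_hull_convex_hull by auto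
    then show ?thesis using p(5) y(2) by (simp add: L_def)
  qed
  note apex = lattice_pyramid_if_apex[OF assms(1) P_hull finV _ v(2) p(2) _ _ this]
  have "V \<subseteq> M" "g (v, 1) = 1" "\<And>w. w \<in> V - {v} \<Longrightarrow> g (w, 1) = 0"
    using p(3,4) v(1) by (auto simp: V_def W_def)
  with apex show ?thesis using assms(3) by metis
qed

end
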